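(* Let $n\ge 3$ and let $Q\in\mathbf S(s_1,\dots,s_n)$ be tangential, with inscribed circle $\sigma(Q)$ of signed radius $r$ and center $O$. If $r>0$, then $Q$ is a nondegenerate (Morse) critical point of $\mathcal P|_{\mathbf S}$ and its Morse index is $$\mu_Q(\mathcal P)=RT-1+2\omega_Q-\begin{cases}1,&\mathcal P(Q)>0,\\0,&\text{otherwise}.\end{cases}$$ If $r<0$, then $$\mu_Q(\mathcal P)=n-3-\mu_{-Q}(\mathcal P)=LT-1-2\omega_Q-\begin{cases}1,&\mathcal P(Q)>0,\\0,&\text{otherwise}.\end{cases}$$
   Context: Fix $n\ge 3$ pairwise non-parallel lines $s_1,\dots,s_n\subset\mathbb{R}^2$ through the origin, each with a fixed direction $\vec s_i$. For lines $e_i\parallel s_i$, $Q=Q(e_1,\dots,e_n)$ is the closed polygon with consecutive vertices $v_i=e_i\cap e_{i+1}$ (indices mod $n$), and $\widetilde{\mathbf S}(s_1,\dots,s_n)$ is the space of such polygons modulo translations. Oriented area: $\mathcal A=\frac12\sum_i(x_iy_{i+1}-x_{i+1}y_i)$ for $v_i=(x_i,y_i)$; $\mathbf S=\{Q\in\widetilde{\mathbf S}:|\mathcal A(Q)|=1\}$. Each $e_i$ is oriented along $\vec s_i$, giving $\vec e_i$; the perimeter is $\mathcal P(Q)=\sum_i\operatorname{sign}_Q(i)|v_iv_{i+1}|$ with $\operatorname{sign}_Q(i)=1$ if $\vec e_i$ is codirected with $\overrightarrow{v_iv_{i+1}}$ and $-1$ otherwise. $Q$ is tangential if there is a circle $\sigma$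 tangent to every $e_i$ lying either to the left of all $\vec e_i$ or to the right of all $\vec e_i$; its signed radius is its radius with sign $+$ if it lies to the left and $-$ otherwise. $-Q=Q(-e_1,\dots,-e_n)$ (point reflection). $\omega_Q$ is the winding number of the closed broken line $v_1v_2\dots v_n$ around $O$. For an ordered pair of directed slopes $(\vec s_i,\vec s_j)$ we have a right turn (resp. left turn) if $\vec s_j$ is obtained from $\vec s_i$ by a clockwise (resp. counterclockwise) rotation by an angle smaller than $\pi$. $RT$ (resp. $LT$) is the number of right (resp. left) turns among the pairs $(\vec s_1,\vec s_2),(\vec s_2,\vec s_3),\dots,(\vec s_n,\vec s_1)$. $\mu_Q(\mathcal P)$ is the number of negative eigenvalues of the Hessian of $\mathcal P|_{\mathbf S}$ at $Q$. *)

theory Defs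
  imports "HOL-Analysis.Analysis"
begin

definition cross :: "complex \<Rightarrow> complex \<Rightarrow> real" where
  "cross a b = Im (cnj a * b)"

text \<open>The line e_i parallel to the direction d i, given by its offset h i:
  e_i = {p. cross (d i) p = h i}.  Indices are taken modulo n by the callers.\<close>
definition eline :: "(nat \<Rightarrow> complex) \<Rightarrow> (nat \<Rightarrow> real) \<Rightarrow> nat \<Rightarrow> complex set" where
  "eline d h i = {p. cross (d i) p = h i}"

definition vert :: "nat \<Rightarrow> (nat \<Rightarrow> complex) \<Rightarrow> (nat \<Rightarrow> real) \<Rightarrow> nat \<Rightarrow> complex" where
  "vert n d h i = (THE p. p \<in> eline d h (i mod n) \<inter> eline d h (Suc i mod n))"

definition area :: "nat \<Rightarrow> (nat \<Rightarrow> complex) \<Rightarrow> (nat \<Rightarrow> real) \<Rightarrow> real" where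
  "area n d h = (1/2) * (\<Sum>i<n. Re (vert n d h i) * Im (vert n d h (Suc i))
                              - Re (vert n d h (Suc i)) * Im (vert n d h i))"

text \<open>Signed perimeter.  The side v_i v_(i+1) lies on the line e_(i+1); its sign is +1
  iff the vector from v_i to v_(i+1) is codirected with the orientation of that line.\<close>
definition perim :: "nat \<Rightarrow> (nat \<Rightarrow> complex) \<Rightarrow> (nat \<Rightarrow> real) \<Rightarrow> real" where
  "perim n d h = (\<Sum>i<n.
     (if (\<exists>t::real\<ge>0. vert n d h (Suc i) - vert n d h i = of_real t * d (Suc i mod n)) then 1 else -1)
       * cmod (vert n d h (Suc i) - vert n d h i))"

text \<open>Inscribed circle with center X and signed radius r: the circle of radius |r|
  around X is tangent to every e_i, and lies to the left of all directed lines if r > 0,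
  to the right of all of them if r < 0.\<close>
definition is_incircle :: "nat \<Rightarrow> (nat \<Rightarrow> complex) \<Rightarrow> (nat \<Rightarrow> real) \<Rightarrow> complex \<Rightarrow> real \<Rightarrow> bool" where
  "is_incircle n d h X r \<longleftrightarrow> r \<noteq> 0 \<and>
     (\<forall>i<n. infdist X (eline d h i) = \<bar>r\<bar>) \<and>
     (r > 0 \<longrightarrow> (\<forall>i<n. cross (d i) X > h i)) \<and>
     (r < 0 \<longrightarrow> (\<forall>i<n. cross (d i) X < h i))"

definition winding_poly :: "nat \<Rightarrow> (nat \<Rightarrow> complex) \<Rightarrow> (nat \<Rightarrow> real) \<Rightarrow> complex \<Rightarrow> real" where
  "winding_poly n d h X =
     (\<Sum>i<n. Arg ((vert n d h (Suc i) - X) / (vert n d h i - X))) / (2 * pi)"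

definition RT :: "nat \<Rightarrow> (nat \<Rightarrow> complex) \<Rightarrow> nat" where
  "RT n d = card {i. i < n \<and> cross (d i) (d (Suc i mod n)) < 0}"

definition LT :: "nat \<Rightarrow> (nat \<Rightarrow> complex) \<Rightarrow> nat" where
  "LT n d = card {i. i < n \<and> cross (d i) (d (Suc i mod n)) > 0}"

text \<open>A polygon is determined by the offsets of its lines; we use the vector
  x :: real^'n of offsets, where the coordinate ix i (i < n = CARD('n)) is the offset
  of the line e_i.  Translations are factored out by the global section
  "v_0 = 0", i.e. x $ ix 0 = 0 and x $ ix 1 = 0 (every polygon has exactly one such
  translate since s_0, s_1 are not parallel).\<close>
definition offs :: "(nat \<Rightarrow> 'n::finite) \<Rightarrow> real^'n \<Rightarrow> nat \<Rightarrow> real" where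
  "offs ix x i = x $ ix (i mod CARD('n))"

definition polyS :: "(nat \<Rightarrow> complex) \<Rightarrow> (nat \<Rightarrow> 'n::finite) \<Rightarrow> (real^'n) set" where
  "polyS d ix = {x. x $ ix 0 = 0 \<and> x $ ix 1 = 0 \<and> \<bar>area CARD('n) d (offs ix x)\<bar> = 1}"

definition perimF :: "(nat \<Rightarrow> complex) \<Rightarrow> (nat \<Rightarrow> 'n::finite) \<Rightarrow> real^'n \<Rightarrow> real" where
  "perimF d ix x = perim CARD('n) d (offs ix x)"

definition C2_curve_at :: "'a::real_normed_vector set \<Rightarrow> 'a \<Rightarrow> (real \<Rightarrow> 'a) \<Rightarrow> bool" where
  "C2_curve_at M x \<gamma> \<longleftrightarrow> \<gamma> 0 = x \<and>
     (\<exists>\<epsilon>>0. (\<forall>t\<in>{-\<epsilon><..<\<epsilon>}. \<gamma> t \<in> M) \<and>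
        (\<exists>\<gamma>1 \<gamma>2. (\<forall>t\<in>{-\<epsilon><..<\<epsilon>}. (\<gamma> has_vector_derivative \<gamma>1 t) (at t) \<and>
                                   (\<gamma>1 has_vector_derivative \<gamma>2 t) (at t)) \<and>
                 continuous_on {-\<epsilon><..<\<epsilon>} \<gamma>2))"

definition tangent_space :: "'a::real_normed_vector set \<Rightarrow> 'a \<Rightarrow> 'a set" where
  "tangent_space M x = {vector_derivative \<gamma> (at 0) | \<gamma>. C2_curve_at M x \<gamma>}"

definition critical_point :: "('a::real_normed_vector \<Rightarrow> real) \<Rightarrow> 'a set \<Rightarrow> 'a \<Rightarrow> bool" where
  "critical_point f M x \<longleftrightarrow> x \<in> M \<and> (\<forall>\<gamma>. C2_curve_at M x \<gamma> \<longrightarrow> deriv (f \<circ> \<gamma>) 0 = 0)"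

definition hessian_form :: "('a::real_normed_vector \<Rightarrow> real) \<Rightarrow> 'a set \<Rightarrow> 'a \<Rightarrow> 'a \<Rightarrow> real" where
  "hessian_form f M x v = (THE q. \<forall>\<gamma>. C2_curve_at M x \<gamma> \<and> vector_derivative \<gamma> (at 0) = v
                                     \<longrightarrow> deriv (deriv (f \<circ> \<gamma>)) 0 = q)"

definition nondeg_critical_point :: "('a::real_normed_vector \<Rightarrow> real) \<Rightarrow> 'a set \<Rightarrow> 'a \<Rightarrow> bool" where
  "nondeg_critical_point f M x \<longleftrightarrow> critical_point f M x \<and>
     (\<forall>u\<in>tangent_space M x.
        (\<forall>w\<in>tangent_space M x. hessian_form f M x (u + w) - hessian_form f M x u
                                  - hessian_form f M x w = 0) \<longrightarrow> u = 0)"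

text \<open>Morse index = number of negative eigenvalues of the Hessian (counted with
  multiplicity) = maximal dimension of a subspace of the tangent space on which the
  Hessian is negative definite (Sylvester).\<close>
definition morse_index :: "('a::euclidean_space \<Rightarrow> real) \<Rightarrow> 'a set \<Rightarrow> 'a \<Rightarrow> nat" where
  "morse_index f M x = Max {dim V | V. subspace V \<and> V \<subseteq> tangent_space M x \<and>
                              (\<forall>v\<in>V. v \<noteq> 0 \<longrightarrow> hessian_form f M x v < 0)}"

end

theory Submission
  imports Defs
begin

text \<open>
  The area is a quadratic form in the offsets. Cutting the polygon into the triangles bounded by
  the lines \<open>e_(m-1)\<close>, \<open>e_m\<close>, \<open>e_0\<close> diagonalises it as
  \<open>\<Sum>m=2..<n. C_m (L_m h)\<^sup>2\<close>. The perimeter is linear; if the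
  polygon \<open>Q\<close> has an inscribed circle of signed radius \<open>r\<close>, its offsets are
  \<open>- r \<bar>d_i\<bar>\<close> up to a translation, and the perimeter equals
  \<open>(2/r) B(Q, _)\<close> with \<open>B\<close> the polarised area. Hence \<open>Q\<close> is critical,
  the tangent space is the \<open>B\<close>-orthogonal complement of \<open>Q\<close>, and the Hessian is
  \<open>- (2/r) B\<close> on it, so the Morse index is the number of \<open>m\<close> with
  \<open>r C_m > 0\<close>, minus 1 if \<open>(2/r) B(Q, Q) = P(Q)\<close> is positive. The signs of
  the \<open>C_m\<close> are counted by adding the lines one at a time: the turning angles of the directions
  add up to \<open>2 \<pi>\<close> times the winding number, and each triangle with \<open>C_m > 0\<close>
  raises (right turns) + (turning angle)/\<open>\<pi>\<close> by exactly one, the others leave it unchanged.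
\<close>

section \<open>Diagonal quadratic forms and their level sets\<close>

text \<open>\<open>separating\<close> and \<open>interpolating\<close> together say that the
  \<open>L i\<close> are linear coordinates on \<open>W\<close>. The form \<open>B\<close> is
  diagonal in them and, by \<open>C_nonzero\<close>, nondegenerate on \<open>W\<close>.\<close>

locale diagonal_form =
  fixes I :: "'i set" and C :: "'i \<Rightarrow> real" and L :: "'i \<Rightarrow> 'a::euclidean_space \<Rightarrow> real"
    and W :: "'a set"
  assumes finite_I: "finite I"
    and subspace_W: "subspace W"
    and linear_L: "\<And>i. i \<in> I \<Longrightarrow> linear (L i)"
    and separating: "\<And>w. w \<in> W \<Longrightarrow> (\<And>i. i \<in> I \<Longrightarrow> L i w = 0) \<Longrightarrow> w = 0"
    and interpolating: "\<And>c. \<exists>w\<in>W. \<forall>i\<in>I. L i w = c i"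
    and C_nonzero: "\<And>i. i \<in> I \<Longrightarrow> C i \<noteq> 0"
begin

definition B :: "'a \<Rightarrow> 'a \<Rightarrow> real" where
  "B u v = (\<Sum>i\<in>I. C i * L i u * L i v)"

lemma B_sym: "B u v = B v u"
  unfolding B_def by (rule sum.cong) auto

lemma bounded_bilinear_B: "bounded_bilinear B"
proof -
  have lin: "linear (B u)" for u
  proof (rule linearI)
    show "B u (v + w) = B u v + B u w" for v w
      unfolding B_def sum.distrib[symmetric]
      by (rule sum.cong) (simp_all add: linear_add[OF linear_L] ring_distribs)
    show "B u (c *\<^sub>R v) = c *\<^sub>R B u v" for c v
      unfolding B_def scaleR_sum_right
      by (rule sum.cong) (simp_all add: linear_scale[OF linear_L])
  qed
  moreover have "(\<lambda>u. B u v) = B v" for v using B_sym by blast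
  ultimately have "bilinear B" unfolding bilinear_def by simp
  then show ?thesis by (simp add: bilinear_conv_bounded_bilinear)
qed

sublocale B: bounded_bilinear B by (rule bounded_bilinear_B)

definition coord_subspace :: "'i set \<Rightarrow> 'a set" where
  "coord_subspace J = {w \<in> W. \<forall>i\<in>I - J. L i w = 0}"

lemma subspace_coord: "subspace (coord_subspace J)"
  using subspace_W unfolding subspace_def coord_subspace_def
  by (auto simp: linear_add[OF linear_L] linear_scale[OF linear_L] linear_0[OF linear_L])

text \<open>The vectors of \<open>W\<close> dual to the coordinates, taken for the indices in
  \<open>J\<close>, form a basis: duality gives independence, \<open>separating\<close> gives the
  span.\<close>

lemma dim_coord_subspace:
  assumes J: "J \<subseteq> I"
  shows "dim (coord_subspace J) = card J"
proof -
  have "\<forall>i. \<exists>w. w \<in> W \<and> (\<forall>j\<in>I. L j w = of_bool (j = i))"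
  proof
    fix i
    show "\<exists>w. w \<in> W \<and> (\<forall>j\<in>I. L j w = of_bool (j = i))"
      using interpolating[of "\<lambda>j. of_bool (j = i)"] by blast
  qed
  from choice[OF this] obtain b where bW: "\<And>i. b i \<in> W"
    and b: "\<And>i j. j \<in> I \<Longrightarrow> L j (b i) = of_bool (j = i)" by blast
  have finJ: "finite J" using J finite_I finite_subset by blast
  have inj: "inj_on b J"
  proof (rule inj_onI)
    fix i j assume "i \<in> J" "j \<in> J" and eq: "b i = b j"
    then have iI: "i \<in> I" using J by blast
    have "of_bool (i = j) = L i (b j)" by (rule b[OF iI, symmetric])
    also have "\<dots> = L i (b i)" by (simp only: eq)
    also have "\<dots> = 1" using b[OF iI, of i] by simp
    finally show "i = j" by (simp only: of_bool_eq_1_iff)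
  qed
  have L_sum: "L j (\<Sum>i\<in>J. c i *\<^sub>R b i) = (if j \<in> J then c j else 0)" if "j \<in> I" for c j
  proof -
    have "L j (\<Sum>i\<in>J. c i *\<^sub>R b i) = (\<Sum>i\<in>J. if j = i then c i else 0)"
      unfolding linear_sum[OF linear_L[OF that]]
      by (rule sum.cong) (auto simp: linear_scale[OF linear_L[OF that]] b[OF that])
    then show ?thesis using finJ by simp
  qed
  have "independent (b ` J)"
  proof (rule independent_if_scalars_zero)
    show "finite (b ` J)" using finJ by simp
    fix f y assume "(\<Sum>y\<in>b ` J. f y *\<^sub>R y) = 0" and "y \<in> b ` J"
    then obtain j where j: "j \<in> J" "y = b j" by auto
    have "(\<Sum>i\<in>J. f (b i) *\<^sub>R b i) = 0"
      using \<open>(\<Sum>y\<in>b ` J. f y *\<^sub>R y) = 0\<close> inj by (simp add: sum.reindex)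
    moreover have "j \<in> I" using j J by blast
    ultimately show "f y = 0"
      using L_sum[of j "\<lambda>i. f (b i)"] j linear_0[OF linear_L[of j]] by simp
  qed
  moreover have "b ` J \<subseteq> coord_subspace J"
    using bW b by (auto simp: coord_subspace_def)
  moreover have "coord_subspace J \<subseteq> span (b ` J)"
  proof
    fix w assume w: "w \<in> coord_subspace J"
    let ?s = "\<Sum>i\<in>J. L i w *\<^sub>R b i"
    have "?s \<in> W"
      by (intro subspace_sum[OF subspace_W] subspace_scale[OF subspace_W] bW)
    moreover have "w \<in> W" using w by (simp add: coord_subspace_def)
    ultimately have "w - ?s \<in> W" by (intro subspace_diff[OF subspace_W])
    moreover have "L i (w - ?s) = 0" if "i \<in> I" for i
      using w that unfolding linear_diff[OF linear_L[OF that]] L_sum[OF that]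
      by (simp add: coord_subspace_def)
    ultimately have "w - ?s = 0" by (rule separating)
    then have "w = ?s" by simp
    moreover have "?s \<in> span (b ` J)" by (intro span_sum span_scale span_base) auto
    ultimately show "w \<in> span (b ` J)" by simp
  qed
  ultimately have "card (b ` J) = dim (coord_subspace J)"
    by (intro basis_card_eq_dim) auto
  then show ?thesis using card_image[OF inj] by simp
qed

lemma dim_W: "dim W = card I"
  using dim_coord_subspace[of I] by (simp add: coord_subspace_def)

lemma B_pos_on_coord_subspace:
  assumes "w \<in> coord_subspace {i \<in> I. 0 < C i}" "w \<noteq> 0"
  shows "0 < B w w"
proof -
  have nn: "0 \<le> C i * L i w * L i w" if "i \<in> I" for i
    using assms that by (cases "0 < C i") (auto simp: coord_subspace_def mult.assoc)
  obtain i where i: "i \<in> I" "L i w \<noteq> 0"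
    using separating[of w] assms by (auto simp: coord_subspace_def)
  then have "0 < C i" using assms by (auto simp: coord_subspace_def)
  then have "0 < C i * L i w * L i w" using i by (simp add: mult.assoc zero_less_mult_iff) linarith
  then show ?thesis unfolding B_def using i nn finite_I by (intro sum_pos2) auto
qed

lemma B_nonpos_on_coord_subspace:
  assumes "w \<in> coord_subspace {i \<in> I. C i < 0}"
  shows "B w w \<le> 0"
  unfolding B_def
proof (rule sum_nonpos)
  fix i assume "i \<in> I"
  then show "C i * L i w * L i w \<le> 0"
    using assms by (cases "C i < 0") (auto simp: coord_subspace_def mult.assoc mult_nonpos_nonneg)
qed

section \<open>Inertia of the form on \<open>W\<close> and on orthogonal complements\<close>

definition pos_count :: nat where "pos_count = card {i \<in> I. 0 < C i}"

lemma card_I_eq: "card I = pos_count + card {i \<in> I. C i < 0}"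
proof -
  have "I = {i \<in> I. 0 < C i} \<union> {i \<in> I. C i < 0}" using C_nonzero by (auto simp: linorder_neq_iff)
  then have "card I = card ({i \<in> I. 0 < C i} \<union> {i \<in> I. C i < 0})" by simp
  also have "\<dots> = pos_count + card {i \<in> I. C i < 0}"
    unfolding pos_count_def using finite_I by (intro card_Un_disjoint) auto
  finally show ?thesis .
qed

text \<open>On the coordinate subspace of the negative coefficients the form is nonpositive, so
  \<open>V\<close> meets it only in 0 and the two dimensions add up to at most
  \<open>dim W\<close>.\<close>

lemma dim_pos_def_le:
  assumes V: "subspace V" "V \<subseteq> W" and pos: "\<And>v. v \<in> V \<Longrightarrow> v \<noteq> 0 \<Longrightarrow> 0 < B v v"
  shows "dim V \<le> pos_count"
proof -
  define N where "N = coord_subspace {i \<in> I. C i < 0}"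
  have N: "subspace N" "N \<subseteq> W" "dim N = card {i \<in> I. C i < 0}"
    unfolding N_def using subspace_coord dim_coord_subspace[of "{i \<in> I. C i < 0}"]
    by (auto simp: coord_subspace_def)
  have "V \<inter> N \<subseteq> {0}"
    using pos B_nonpos_on_coord_subspace unfolding N_def by force
  then have "dim (V \<inter> N) = 0" by (simp only: dim_eq_0)
  then have "dim {v + w |v w. v \<in> V \<and> w \<in> N} = dim V + dim N"
    using dim_sums_Int[OF V(1) N(1)] by linarith
  moreover have "{v + w |v w. v \<in> V \<and> w \<in> N} \<subseteq> W"
    using V N by (auto intro!: subspace_add[OF subspace_W])
  then have "dim {v + w |v w. v \<in> V \<and> w \<in> N} \<le> dim W" by (rule dim_subset)
  ultimately show ?thesis using N(3) dim_W card_I_eq by linarith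
qed

definition orth :: "'a \<Rightarrow> 'a set" where "orth x = {v \<in> W. B x v = 0}"

lemma subspace_orth: "subspace (orth x)"
  using subspace_W unfolding subspace_def orth_def
  by (auto simp: B.zero_right B.add_right B.scaleR_right)

text \<open>As \<open>x\<close> is orthogonal to \<open>V\<close> and itself positive, adjoining it
  to \<open>V\<close> gives a positive definite subspace of one more dimension.\<close>

lemma dim_pos_def_orth_le:
  assumes x: "x \<in> W" "0 < B x x"
    and V: "subspace V" "V \<subseteq> orth x" and pos: "\<And>v. v \<in> V \<Longrightarrow> v \<noteq> 0 \<Longrightarrow> 0 < B v v"
  shows "dim V + 1 \<le> pos_count"
proof -
  have "x \<notin> span V" using x V by (auto simp: orth_def span_eq_iff[THEN iffD2])
  then have "dim (span (insert x V)) = dim V + 1" by (simp add: dim_insert)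
  moreover have "dim (span (insert x V)) \<le> pos_count"
  proof (rule dim_pos_def_le)
    show "span (insert x V) \<subseteq> W"
      using x V subspace_W by (intro span_minimal) (auto simp: orth_def)
    fix u assume u: "u \<in> span (insert x V)" "u \<noteq> 0"
    then obtain c where "u - c *\<^sub>R x \<in> span V" by (auto simp: span_breakdown_eq)
    then obtain v where v: "v \<in> V" "u = v + c *\<^sub>R x"
      using V(1) by (metis diff_add_cancel span_eq_iff)
    have "B x v = 0" "B v x = 0" using v V B_sym by (auto simp: orth_def)
    then have Bu: "B u u = B v v + c\<^sup>2 * B x x"
      unfolding v(2) by (simp add: B.add_left B.add_right B.scaleR_left B.scaleR_right power2_eq_square)
    show "0 < B u u"
    proof (cases "v = 0")
      case True
      then have "c \<noteq> 0" using u v by auto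
      then show ?thesis using Bu True x by (simp add: B.zero_left)
    next
      case False
      then show ?thesis using Bu pos[OF v(1)] x by (simp add: add_pos_nonneg)
    qed
  qed auto
  ultimately show ?thesis by simp
qed

text \<open>Start from the positive coordinate subspace \<open>P\<close>. If \<open>B x x\<close> is
  positive, cutting \<open>P\<close> with the hyperplane \<open>orth x\<close> costs at most one
  dimension; if it is negative, projecting \<open>P\<close> along \<open>x\<close> costs
  none.\<close>

lemma exists_pos_def_orth:
  assumes x: "x \<in> W" "B x x \<noteq> 0"
  shows "\<exists>V. subspace V \<and> V \<subseteq> orth x \<and> (\<forall>v\<in>V. v \<noteq> 0 \<longrightarrow> 0 < B v v) \<and>
    pos_count \<le> dim V + (if 0 < B x x then 1 else 0)"
proof -
  define P where "P = coord_subspace {i \<in> I. 0 < C i}"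
  have P: "subspace P" "P \<subseteq> W" "dim P = pos_count" "\<And>v. v \<in> P \<Longrightarrow> v \<noteq> 0 \<Longrightarrow> 0 < B v v"
    unfolding P_def pos_count_def
    using subspace_coord dim_coord_subspace[of "{i \<in> I. 0 < C i}"] B_pos_on_coord_subspace
    by (auto simp: coord_subspace_def)
  show ?thesis
  proof (cases "0 < B x x")
    case True
    have "pos_count \<le> dim (P \<inter> orth x) + 1"
    proof (cases "\<exists>p\<in>P. B x p \<noteq> 0")
      case True
      then obtain p where p: "p \<in> P" "B x p \<noteq> 0" by auto
      have "P \<subseteq> span (insert p (P \<inter> orth x))"
      proof
        fix w assume w: "w \<in> P"
        have "w - (B x w / B x p) *\<^sub>R p \<in> P \<inter> orth x"
          using w p P by (auto simp: orth_def B.diff_right B.scaleR_right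
              intro!: subspace_diff subspace_scale subspace_W)
        then show "w \<in> span (insert p (P \<inter> orth x))"
          unfolding span_breakdown_eq by (auto intro: span_base)
      qed
      then have "dim P \<le> dim (insert p (P \<inter> orth x))" by (metis dim_span dim_subset)
      then show ?thesis using P(3) by (simp add: dim_insert split: if_splits)
    next
      case False
      then have "P \<inter> orth x = P" using P by (auto simp: orth_def)
      then show ?thesis using P(3) by simp
    qed
    then show ?thesis
      using P True subspace_orth by (intro exI[of _ "P \<inter> orth x"]) (auto intro!: subspace_inter)
  next
    case False
    then have neg: "B x x < 0" using x by simp
    \<comment> \<open>The \<open>B\<close>-orthogonal projection along \<open>x\<close>. Since
      \<open>B x x < 0\<close>, it cannot decrease \<open>B w w\<close>, so the image of
      \<open>P\<close> stays positive definite and nothing in \<open>P\<close> collapses.\<close>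
    define \<pi> where "\<pi> w = w - (B x w / B x x) *\<^sub>R x" for w
    have lin: "linear \<pi>"
      unfolding \<pi>_def linear_iff
      by (auto simp: B.add_right B.scaleR_right add_divide_distrib algebra_simps)
    have B\<pi>: "B (\<pi> w) (\<pi> w) = B w w - (B x w)\<^sup>2 / B x x" for w
      using x B_sym[of w x] unfolding \<pi>_def
      by (simp add: B.diff_left B.diff_right B.scaleR_left B.scaleR_right power2_eq_square)
    have pos: "0 < B (\<pi> w) (\<pi> w)" if "w \<in> P" "w \<noteq> 0" for w
    proof -
      have "(B x w)\<^sup>2 / B x x \<le> 0" using neg by (simp add: divide_nonneg_neg)
      then show ?thesis using P(4)[OF that] B\<pi>[of w] by linarith
    qed
    have "inj_on \<pi> P"
    proof (rule inj_onI, rule ccontr)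
      fix u w assume "u \<in> P" "w \<in> P" "\<pi> u = \<pi> w" "u \<noteq> w"
      then have "\<pi> (u - w) = 0" "u - w \<in> P" "u - w \<noteq> 0"
        using P(1) by (auto simp: linear_diff[OF lin] subspace_diff)
      then show False using pos[of "u - w"] by (simp add: B.zero_left)
    qed
    then have "dim (\<pi> ` P) = pos_count"
      using dim_image_eq[OF lin, of P] P by (simp add: span_eq_iff[THEN iffD2])
    moreover have "subspace (\<pi> ` P)" using lin P(1) by (rule linear_subspace_image)
    moreover have "\<pi> ` P \<subseteq> orth x"
      using P x subspace_W by (auto simp: orth_def \<pi>_def B.diff_right B.scaleR_right
          intro!: subspace_diff subspace_scale)
    moreover have "\<forall>v\<in>\<pi> ` P. v \<noteq> 0 \<longrightarrow> 0 < B v v"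
      using pos linear_0[OF lin] by (auto simp: image_iff)
    ultimately show ?thesis using False by (intro exI[of _ "\<pi> ` P"]) auto
  qed
qed

lemma Max_dim_pos_def_orth:
  assumes x: "x \<in> W" "B x x \<noteq> 0"
  shows "Max {dim V |V. subspace V \<and> V \<subseteq> orth x \<and> (\<forall>v\<in>V. v \<noteq> 0 \<longrightarrow> 0 < B v v)}
      + (if 0 < B x x then 1 else 0) = pos_count"
proof -
  have upper: "dim V + (if 0 < B x x then 1 else 0) \<le> pos_count"
    if "subspace V" "V \<subseteq> orth x" "\<forall>v\<in>V. v \<noteq> 0 \<longrightarrow> 0 < B v v" for V
    using that dim_pos_def_orth_le[OF x(1), of V] dim_pos_def_le[of V] by (auto simp: orth_def)
  obtain V where V: "subspace V" "V \<subseteq> orth x" "\<forall>v\<in>V. v \<noteq> 0 \<longrightarrow> 0 < B v v"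
    "pos_count \<le> dim V + (if 0 < B x x then 1 else 0)"
    using exists_pos_def_orth[OF x] by blast
  define \<V> where "\<V> = {V. subspace V \<and> V \<subseteq> orth x \<and> (\<forall>v\<in>V. v \<noteq> 0 \<longrightarrow> 0 < B v v)}"
  have le: "dim U \<le> dim V" if "U \<in> \<V>" for U
  proof -
    have "dim U + (if 0 < B x x then 1 else 0) \<le> pos_count"
      using that by (intro upper) (simp_all add: \<V>_def)
    then show ?thesis using V(4) by linarith
  qed
  have "V \<in> \<V>" using V by (simp add: \<V>_def)
  moreover have "finite (dim ` \<V>)"
    using le by (intro finite_subset[of "dim ` \<V>" "{..dim V}"] image_subsetI) simp_all
  ultimately have "Max (dim ` \<V>) = dim V"
    using le by (intro Max_eqI imageI) auto
  then show ?thesis using V(4) upper[OF V(1-3)] unfolding setcompr_eq_image \<V>_def by linarith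
qed

text \<open>\<open>W\<close> is spanned by \<open>orth x\<close> and \<open>x\<close>, so
  \<open>B u\<close> vanishes on all of \<open>W\<close>, where the diagonal form is
  nondegenerate.\<close>

lemma nondegenerate_on_orth:
  assumes x: "x \<in> W" "B x x \<noteq> 0" and u: "u \<in> orth x" "\<And>w. w \<in> orth x \<Longrightarrow> B u w = 0"
  shows "u = 0"
proof -
  have all: "B u w = 0" if "w \<in> W" for w
  proof -
    have "w - (B x w / B x x) *\<^sub>R x \<in> orth x"
      using that x subspace_W by (auto simp: orth_def B.diff_right B.scaleR_right
          intro!: subspace_diff subspace_scale)
    then have "B u (w - (B x w / B x x) *\<^sub>R x) = 0" by (rule u(2))
    moreover have "B u x = 0" using u(1) B_sym by (auto simp: orth_def)
    ultimately show ?thesis by (simp add: B.diff_right B.scaleR_right)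
  qed
  \<comment> \<open>This \<open>w\<close> turns \<open>B u w\<close> into the sum of the squares of
    \<open>C i * L i u\<close>.\<close>
  obtain w where w: "w \<in> W" "\<And>i. i \<in> I \<Longrightarrow> L i w = C i * L i u"
    using interpolating[of "\<lambda>i. C i * L i u"] by blast
  have "(\<Sum>i\<in>I. (C i * L i u)\<^sup>2) = B u w"
    unfolding B_def by (rule sum.cong) (auto simp: w(2) power2_eq_square)
  then have "\<forall>i\<in>I. (C i * L i u)\<^sup>2 = 0"
    using all[OF w(1)] finite_I by (simp add: sum_nonneg_eq_0_iff)
  then show ?thesis using u C_nonzero by (intro separating) (auto simp: orth_def)
qed

section \<open>Second-order calculus on level sets of the form\<close>

definition level_set :: "real \<Rightarrow> 'a set" where
  "level_set \<kappa> = {y \<in> W. \<bar>\<kappa> * B y y\<bar> = 1}"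

lemma B_nonzero_on_level_set: "y \<in> level_set \<kappa> \<Longrightarrow> B y y \<noteq> 0"
  by (auto simp: level_set_def)

text \<open>Differentiating the constraint along the curve gives
  \<open>B \<gamma> \<gamma>' = 0\<close>, and once more
  \<open>B \<gamma> \<gamma>'' = - B \<gamma>' \<gamma>'\<close>. As \<open>B x\<close> is linear,
  its second derivative at 0 is \<open>B x \<gamma>''\<close>, hence determined by the velocity
  alone.\<close>

lemma curve_derivatives:
  assumes "C2_curve_at (level_set \<kappa>) x \<gamma>"
  shows "vector_derivative \<gamma> (at 0) \<in> orth x"
    and "deriv (B x \<circ> \<gamma>) 0 = 0"
    and "deriv (deriv (B x \<circ> \<gamma>)) 0 = - B (vector_derivative \<gamma> (at 0)) (vector_derivative \<gamma> (at 0))"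
proof -
  obtain \<epsilon> \<gamma>1 \<gamma>2 where x: "\<gamma> 0 = x" and "\<epsilon> > 0"
    and M: "\<And>t. t \<in> {-\<epsilon><..<\<epsilon>} \<Longrightarrow> \<gamma> t \<in> level_set \<kappa>"
    and d1: "\<And>t. t \<in> {-\<epsilon><..<\<epsilon>} \<Longrightarrow> (\<gamma> has_vector_derivative \<gamma>1 t) (at t)"
    and d2: "\<And>t. t \<in> {-\<epsilon><..<\<epsilon>} \<Longrightarrow> (\<gamma>1 has_vector_derivative \<gamma>2 t) (at t)"
    using assms unfolding C2_curve_at_def by blast
  have 0: "0 \<in> {-\<epsilon><..<\<epsilon>}" using \<open>\<epsilon> > 0\<close> by simp
  have const: "D = 0" if "(f has_real_derivative D) (at t)" "t \<in> {-\<epsilon><..<\<epsilon>}"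
    "\<And>s. s \<in> {-\<epsilon><..<\<epsilon>} \<Longrightarrow> f s = c" for f D t c
  proof -
    have "((\<lambda>_. c) has_real_derivative D) (at t)"
      by (rule has_field_derivative_transform_within_open[OF that(1) open_greaterThanLessThan that(2,3)])
    then show ?thesis using DERIV_unique DERIV_const by blast
  qed
  have B_deriv: "((\<lambda>t. B (f t) (g t)) has_real_derivative B (f t) g' + B f' (g t)) (at t)"
    if "(f has_vector_derivative f') (at t)" "(g has_vector_derivative g') (at t)" for f g f' g' t
    using B.has_vector_derivative[OF that] by (simp add: has_real_derivative_iff_has_vector_derivative)
  have v: "vector_derivative \<gamma> (at 0) = \<gamma>1 0" using d1[OF 0] by (rule vector_derivative_at)
  \<comment> \<open>Each linear equation \<open>z \<bullet> w = 0\<close> that holds on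
    \<open>W\<close> can be differentiated along the curve, so the velocity satisfies it
    too.\<close>
  have "\<gamma>1 0 \<in> (W\<^sup>\<bottom>)\<^sup>\<bottom>"
    unfolding orthogonal_comp_def[of "W\<^sup>\<bottom>"] orthogonal_def
  proof safe
    fix z assume "z \<in> W\<^sup>\<bottom>"
    then have "z \<bullet> \<gamma> t = 0" if "t \<in> {-\<epsilon><..<\<epsilon>}" for t
      using M[OF that] by (auto simp: orthogonal_comp_def orthogonal_def level_set_def inner_commute)
    moreover have "((\<lambda>t. z \<bullet> \<gamma> t) has_real_derivative z \<bullet> \<gamma>1 0) (at 0)"
      using bounded_linear.has_vector_derivative[OF bounded_linear_inner_right d1[OF 0]]
      by (simp add: has_real_derivative_iff_has_vector_derivative)
    ultimately show "z \<bullet> \<gamma>1 0 = 0" using const[OF _ 0] by blast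
  qed
  then have W: "\<gamma>1 0 \<in> W" using orthogonal_comp_self[OF subspace_W] by simp
  have ortho: "B (\<gamma> t) (\<gamma>1 t) = 0" if t: "t \<in> {-\<epsilon><..<\<epsilon>}" for t
  proof -
    \<comment> \<open>Squaring replaces the absolute value in the level-set equation by a
      differentiable constraint.\<close>
    have der: "((\<lambda>t. (\<kappa> * B (\<gamma> t) (\<gamma> t))\<^sup>2) has_real_derivative
        2 * (\<kappa> * B (\<gamma> t) (\<gamma> t)) * (\<kappa> * (B (\<gamma> t) (\<gamma>1 t) + B (\<gamma>1 t) (\<gamma> t)))) (at t)"
      by (rule derivative_eq_intros B_deriv d1 t refl | simp)+
    have "(\<kappa> * B (\<gamma> s) (\<gamma> s))\<^sup>2 = 1" if "s \<in> {-\<epsilon><..<\<epsilon>}" for s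
      using M[OF that] by (simp add: level_set_def power2_eq_1_iff abs_if split: if_splits)
    then have "2 * (\<kappa> * B (\<gamma> t) (\<gamma> t)) * (\<kappa> * (B (\<gamma> t) (\<gamma>1 t) + B (\<gamma>1 t) (\<gamma> t))) = 0"
      by (rule const[OF der t])
    moreover have "\<kappa> * B (\<gamma> t) (\<gamma> t) \<noteq> 0" using M[OF t] by (auto simp: level_set_def)
    ultimately show ?thesis using B_sym[of "\<gamma>1 t" "\<gamma> t"] by auto
  qed
  show "vector_derivative \<gamma> (at 0) \<in> orth x"
    unfolding v orth_def using W ortho[OF 0] x by simp
  have f1: "((B x \<circ> \<gamma>) has_real_derivative B x (\<gamma>1 t)) (at t)" if "t \<in> {-\<epsilon><..<\<epsilon>}" for t
    using B_deriv[OF has_vector_derivative_const d1[OF that], of x] by (simp add: B.zero_left o_def)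
  then show "deriv (B x \<circ> \<gamma>) 0 = 0"
    using DERIV_imp_deriv[OF f1[OF 0]] ortho[OF 0] x by simp
  have "((\<lambda>t. B x (\<gamma>1 t)) has_real_derivative B x (\<gamma>2 0)) (at 0)"
    using B_deriv[OF has_vector_derivative_const d2[OF 0], of x] by (simp add: B.zero_left)
  then have "(deriv (B x \<circ> \<gamma>) has_real_derivative B x (\<gamma>2 0)) (at 0)"
    using 0 DERIV_imp_deriv[OF f1]
    by (elim has_field_derivative_transform_within_open[of _ _ _ "{-\<epsilon><..<\<epsilon>}"]) auto
  then have "deriv (deriv (B x \<circ> \<gamma>)) 0 = B x (\<gamma>2 0)" by (rule DERIV_imp_deriv)
  moreover have "B (\<gamma> 0) (\<gamma>2 0) + B (\<gamma>1 0) (\<gamma>1 0) = 0"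
    using const[OF B_deriv[OF d1[OF 0] d2[OF 0]] 0] ortho by blast
  ultimately show "deriv (deriv (B x \<circ> \<gamma>)) 0
      = - B (vector_derivative \<gamma> (at 0)) (vector_derivative \<gamma> (at 0))"
    unfolding v x by simp
qed

text \<open>The curve is the straight line through \<open>x\<close> in direction \<open>v\<close>, rescaled onto the level set.\<close>

lemma exists_curve:
  assumes x: "x \<in> level_set \<kappa>" and v: "v \<in> orth x"
  shows "\<exists>\<gamma>. C2_curve_at (level_set \<kappa>) x \<gamma> \<and> vector_derivative \<gamma> (at 0) = v"
proof -
  have Bx: "B x x \<noteq> 0" using x by (auto simp: level_set_def)
  \<comment> \<open>By orthogonality, \<open>B\<close> takes the value
    \<open>B x x * (1 + c * t\<^sup>2)\<close> at \<open>x + t *\<^sub>R v\<close>. The choice of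
    \<open>\<epsilon>\<close> keeps the second factor positive, so that its inverse square root can
    serve as the rescaling \<open>g\<close>.\<close>
  define c where "c = B v v / B x x"
  define \<epsilon> where "\<epsilon> = 1 / (1 + \<bar>c\<bar>)"
  have \<epsilon>: "0 < \<epsilon>" "\<epsilon> \<le> 1" "\<bar>c\<bar> * \<epsilon> < 1" by (auto simp: \<epsilon>_def field_simps)
  define U where "U = {-\<epsilon><..<\<epsilon>}"
  have pos: "0 < 1 + c * t\<^sup>2" if "t \<in> U" for t
  proof -
    have t: "\<bar>t\<bar> < \<epsilon>" using that by (auto simp: U_def)
    have "t\<^sup>2 = \<bar>t\<bar> * \<bar>t\<bar>" by (simp add: power2_eq_square)
    also have "\<dots> \<le> \<epsilon> * 1" using t \<epsilon> by (intro mult_mono) auto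
    finally have "\<bar>c\<bar> * t\<^sup>2 \<le> \<bar>c\<bar> * \<epsilon>" by (intro mult_left_mono) auto
    moreover have "- (c * t\<^sup>2) \<le> \<bar>c\<bar> * t\<^sup>2" by (metis abs_ge_minus_self abs_mult abs_power2)
    ultimately show ?thesis using \<epsilon> by linarith
  qed
  define g where "g t = inverse (sqrt (1 + c * t\<^sup>2))" for t
  \<comment> \<open>Both derivatives of \<open>g\<close> are polynomials in \<open>t\<close> and
    \<open>g\<close>, so continuity of \<open>\<gamma>2\<close> reduces to that of
    \<open>g\<close>.\<close>
  define g1 where "g1 t = - (c * t) * g t ^ 3" for t
  define g2 where "g2 t = - c * g t ^ 3 + 3 * (c * t)\<^sup>2 * g t ^ 5" for t
  have g: "(g has_real_derivative g1 t) (at t)" if "t \<in> U" for t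
  proof -
    have "(g has_real_derivative - (inverse (sqrt (1 + c * t\<^sup>2)) * (inverse (sqrt (1 + c * t\<^sup>2)) / 2 * (c * (2 * t)))
        * inverse (sqrt (1 + c * t\<^sup>2)))) (at t)"
      unfolding g_def using pos[OF that]
      by (auto intro!: derivative_eq_intros)
    then show ?thesis by (simp add: g1_def g_def power3_eq_cube mult_ac)
  qed
  have g1: "(g1 has_real_derivative g2 t) (at t)" if "t \<in> U" for t
    unfolding g1_def
    by (rule derivative_eq_intros g that refl)+
       (simp add: g2_def g1_def power2_eq_square power3_eq_cube eval_nat_numeral algebra_simps)
  have contg: "continuous_on U g"
    unfolding g_def using pos by (intro continuous_intros) (auto simp: less_imp_neq[symmetric])
  define \<gamma> where "\<gamma> t = g t *\<^sub>R x + (t * g t) *\<^sub>R v" for t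
  define \<gamma>1 where "\<gamma>1 t = g1 t *\<^sub>R x + (g t + t * g1 t) *\<^sub>R v" for t
  define \<gamma>2 where "\<gamma>2 t = g2 t *\<^sub>R x + (2 * g1 t + t * g2 t) *\<^sub>R v" for t
  have \<gamma>: "(\<gamma> has_vector_derivative \<gamma>1 t) (at t)" if "t \<in> U" for t
    unfolding \<gamma>_def \<gamma>1_def
    by (rule derivative_eq_intros g that refl | simp)+
  have \<gamma>1: "(\<gamma>1 has_vector_derivative \<gamma>2 t) (at t)" if "t \<in> U" for t
    unfolding \<gamma>1_def \<gamma>2_def
    by (rule derivative_eq_intros g g1 that refl | simp)+
  have "continuous_on U \<gamma>2"
    unfolding \<gamma>2_def g2_def g1_def by (intro continuous_intros contg)
  moreover have "\<gamma> t \<in> level_set \<kappa>" if "t \<in> U" for t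
  proof -
    have "B x v = 0" "B v x = 0" using v B_sym by (auto simp: orth_def)
    then have "B (\<gamma> t) (\<gamma> t) = (g t)\<^sup>2 * (B x x + t\<^sup>2 * B v v)"
      unfolding \<gamma>_def
      by (simp add: B.add_left B.add_right B.scaleR_left B.scaleR_right power2_eq_square algebra_simps)
    also have "B x x + t\<^sup>2 * B v v = B x x * (1 + c * t\<^sup>2)"
      using Bx by (simp add: c_def field_simps)
    also have "(g t)\<^sup>2 * \<dots> = B x x"
      using pos[OF that] by (simp add: g_def power_inverse)
    finally have "B (\<gamma> t) (\<gamma> t) = B x x" .
    moreover have "\<gamma> t \<in> W"
      unfolding \<gamma>_def using x v subspace_W
      by (auto simp: level_set_def orth_def intro!: subspace_add subspace_scale)
    ultimately show ?thesis using x by (simp add: level_set_def)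
  qed
  moreover have "\<gamma> 0 = x" by (simp add: \<gamma>_def g_def)
  ultimately have "C2_curve_at (level_set \<kappa>) x \<gamma>"
    unfolding C2_curve_at_def using \<gamma> \<gamma>1 \<epsilon>(1) unfolding U_def by blast
  moreover have "\<gamma>1 0 = v" by (simp add: \<gamma>1_def g1_def g_def)
  then have "vector_derivative \<gamma> (at 0) = v"
    using vector_derivative_at[OF \<gamma>[of 0]] \<epsilon>(1) by (simp add: U_def)
  ultimately show ?thesis by blast
qed

lemma tangent_space_level_set:
  assumes "x \<in> level_set \<kappa>"
  shows "tangent_space (level_set \<kappa>) x = orth x"
proof -
  have "v \<in> tangent_space (level_set \<kappa>) x" if "v \<in> orth x" for v
    using exists_curve[OF assms that] by (auto simp: tangent_space_def)
  then show ?thesis using curve_derivatives(1) by (auto simp: tangent_space_def)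
qed

lemma hessian_form_level_set:
  assumes "x \<in> level_set \<kappa>" "v \<in> orth x"
  shows "hessian_form (B x) (level_set \<kappa>) x v = - B v v"
  unfolding hessian_form_def
proof (rule the_equality)
  show "\<forall>\<gamma>. C2_curve_at (level_set \<kappa>) x \<gamma> \<and> vector_derivative \<gamma> (at 0) = v
      \<longrightarrow> deriv (deriv (B x \<circ> \<gamma>)) 0 = - B v v"
    using curve_derivatives(3) by blast
next
  fix q assume q: "\<forall>\<gamma>. C2_curve_at (level_set \<kappa>) x \<gamma> \<and> vector_derivative \<gamma> (at 0) = v
      \<longrightarrow> deriv (deriv (B x \<circ> \<gamma>)) 0 = q"
  \<comment> \<open>Without a curve of velocity \<open>v\<close> every \<open>q\<close> would
    qualify, and the definite description would not determine a value.\<close>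
  obtain \<gamma> where "C2_curve_at (level_set \<kappa>) x \<gamma>" "vector_derivative \<gamma> (at 0) = v"
    using exists_curve[OF assms] by blast
  then show "q = - B v v" using q curve_derivatives(3)[of \<kappa> x \<gamma>] by auto
qed

text \<open>The polarised Hessian is \<open>-2 * B u w\<close>, so nondegeneracy is that of
  \<open>B\<close> on \<open>orth x\<close>.\<close>

lemma nondeg_critical_point_level_set:
  assumes "x \<in> level_set \<kappa>"
  shows "nondeg_critical_point (B x) (level_set \<kappa>) x"
  unfolding nondeg_critical_point_def critical_point_def tangent_space_level_set[OF assms]
proof (intro conjI ballI allI impI)
  fix u assume u: "u \<in> orth x"
    and 0: "\<forall>w\<in>orth x. hessian_form (B x) (level_set \<kappa>) x (u + w)
      - hessian_form (B x) (level_set \<kappa>) x u - hessian_form (B x) (level_set \<kappa>) x w = 0"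
  have "B u w = 0" if w: "w \<in> orth x" for w
  proof -
    have "u + w \<in> orth x" using subspace_add[OF subspace_orth u w] .
    then have "- B (u + w) (u + w) + B u u + B w w = 0"
      using 0 w u hessian_form_level_set[OF assms] by auto
    then show ?thesis using B_sym[of w u] by (simp add: B.add_left B.add_right)
  qed
  then show "u = 0" using assms u by (intro nondegenerate_on_orth[of x]) (auto simp: level_set_def)
qed (use assms curve_derivatives(2) in auto)

text \<open>The Hessian is \<open>- B\<close> on the tangent space \<open>orth x\<close>, so its
  negative definite subspaces are the positive definite ones of \<open>B\<close>.\<close>

lemma morse_index_level_set:
  assumes "x \<in> level_set \<kappa>"
  shows "morse_index (B x) (level_set \<kappa>) x + (if 0 < B x x then 1 else 0) = pos_count"
proof -
  have "(subspace V \<and> V \<subseteq> orth x \<and> (\<forall>v\<in>V. v \<noteq> 0 \<longrightarrow> hessian_form (B x) (level_set \<kappa>) x v < 0))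
     \<longleftrightarrow> (subspace V \<and> V \<subseteq> orth x \<and> (\<forall>v\<in>V. v \<noteq> 0 \<longrightarrow> 0 < B v v))" for V
    using hessian_form_level_set[OF assms] by (auto simp: subset_iff)
  moreover have "x \<in> W" "B x x \<noteq> 0" using assms by (auto simp: level_set_def)
  ultimately show ?thesis
    unfolding morse_index_def tangent_space_level_set[OF assms]
    using Max_dim_pos_def_orth[of x] by simp
qed

end

section \<open>Area, perimeter and turning\<close>

lemma cross_altdef: "cross a b = Re a * Im b - Im a * Re b"
  by (simp add: cross_def)

lemma cross_commute: "cross b a = - cross a b"
  by (simp add: cross_altdef)

text \<open>The diagonals \<open>\<phi> m 0\<close> telescope, which trades a sum around the polygon
  for a sum over the fan of triangles at index 0 plus a two-sided term. It serves both the area and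
  the count of turns.\<close>

lemma cyclic_sum_eq_fan_sum:
  fixes \<phi> :: "nat \<Rightarrow> nat \<Rightarrow> real"
  assumes "2 \<le> n"
  shows "(\<Sum>i<n. \<phi> i (Suc i mod n)) =
     \<phi> 0 1 + \<phi> 1 0 + (\<Sum>m=2..<n. \<phi> (m - 1) m + \<phi> m 0 - \<phi> (m - 1) 0)"
proof -
  have step: "(\<Sum>i<k. \<phi> i (Suc i)) + \<phi> k 0 =
      \<phi> 0 1 + \<phi> 1 0 + (\<Sum>m=2..<Suc k. \<phi> (m - 1) m + \<phi> m 0 - \<phi> (m - 1) 0)" if "1 \<le> k" for k
    using that
  proof (induction k rule: dec_induct)
    case base
    show ?case by (simp add: lessThan_Suc)
  next
    case (step k)
    then show ?case by (simp add: sum.atLeastLessThan_Suc)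
  qed
  obtain k where k: "n = Suc k" "1 \<le> k" using assms by (cases n) auto
  have "(\<Sum>i<n. \<phi> i (Suc i mod n)) = (\<Sum>i<k. \<phi> i (Suc i)) + \<phi> k 0"
    unfolding k by (simp add: lessThan_Suc)
  then show ?thesis using step[OF k(2)] k(1) by simp
qed

lemma sum_cyclic_shift:
  fixes g :: "nat \<Rightarrow> real"
  shows "(\<Sum>i<n. g (Suc i mod n)) = (\<Sum>i<n. g i)"
proof (cases n)
  case (Suc k)
  have "(\<Sum>i<n. g (Suc i mod n)) = (\<Sum>i<k. g (Suc i)) + g 0"
    unfolding Suc by (simp add: lessThan_Suc)
  also have "\<dots> = (\<Sum>i<Suc k. g i)" by (simp add: sum.lessThan_Suc_shift del: sum.lessThan_Suc)
  finally show ?thesis by (simp add: Suc)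
qed simp

text \<open>\<open>fan_coef d m * (fan_height d m h)\<^sup>2\<close> is the oriented area of the
  triangle bounded by \<open>e_(m-1)\<close>, \<open>e_m\<close> and \<open>e_0\<close>.\<close>

definition fan_coef :: "(nat \<Rightarrow> complex) \<Rightarrow> nat \<Rightarrow> real" where
  "fan_coef d m = - cross (d (m - 1)) (d 0) / (2 * cross (d (m - 1)) (d m) * cross (d m) (d 0))"

text \<open>The offset of \<open>e_m\<close> relative to the point where \<open>e_(m-1)\<close> and
  \<open>e_0\<close> meet, found by expanding \<open>d m\<close> in \<open>d (m - 1)\<close> and
  \<open>d 0\<close>. It vanishes iff the three lines are concurrent.\<close>

definition fan_height :: "(nat \<Rightarrow> complex) \<Rightarrow> nat \<Rightarrow> (nat \<Rightarrow> real) \<Rightarrow> real" where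
  "fan_height d m h = h m - cross (d m) (d 0) / cross (d (m - 1)) (d 0) * h (m - 1)
     - cross (d (m - 1)) (d m) / cross (d (m - 1)) (d 0) * h 0"

definition area_form :: "nat \<Rightarrow> (nat \<Rightarrow> complex) \<Rightarrow> (nat \<Rightarrow> real) \<Rightarrow> (nat \<Rightarrow> real) \<Rightarrow> real" where
  "area_form n d h h' = (\<Sum>m=2..<n. fan_coef d m * fan_height d m h * fan_height d m h')"

text \<open>The polarised oriented area of the quadrilateral formed by the origin, the foot of its
  perpendicular on \<open>e_i\<close>, the point where \<open>e_i\<close> and \<open>e_j\<close>
  meet, and the foot on \<open>e_j\<close>.\<close>

definition edge_form :: "(nat \<Rightarrow> complex) \<Rightarrow> (nat \<Rightarrow> real) \<Rightarrow> (nat \<Rightarrow> real) \<Rightarrow> nat \<Rightarrow> nat \<Rightarrow> real" where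
  "edge_form d h h' i j =
     - ((h i * h' i / (cmod (d i))\<^sup>2 + h j * h' j / (cmod (d j))\<^sup>2) * (d i \<bullet> d j)
        - h i * h' j - h j * h' i) / (2 * cross (d i) (d j))"

text \<open>Three such quadrilaterals around the origin glue to a triangle, whose area depends on a
  single height. Algebraically, the inner products cancel and a form of rank one remains.\<close>

lemma edge_form_cocycle:
  fixes a b c :: complex and s t w s' t' w' :: real
  assumes x: "cross a b \<noteq> 0" and y: "cross b c \<noteq> 0" and z: "cross a c \<noteq> 0"
  shows "- ((s * s' / (cmod a)\<^sup>2 + t * t' / (cmod b)\<^sup>2) * (a \<bullet> b) - s * t' - t * s') / (2 * cross a b)
    + - ((t * t' / (cmod b)\<^sup>2 + w * w' / (cmod c)\<^sup>2) * (b \<bullet> c) - t * w' - w * t') / (2 * cross b c)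
    - - ((s * s' / (cmod a)\<^sup>2 + w * w' / (cmod c)\<^sup>2) * (a \<bullet> c) - s * w' - w * s') / (2 * cross a c)
    = (- cross a c / (2 * cross a b * cross b c))
      * (t - cross b c / cross a c * s - cross a b / cross a c * w)
      * (t' - cross b c / cross a c * s' - cross a b / cross a c * w')"
proof -
  define X Y Z A B C p q u where defs: "X = cross a b" "Y = cross b c" "Z = cross a c"
    "A = (cmod a)\<^sup>2" "B = (cmod b)\<^sup>2" "C = (cmod c)\<^sup>2" "p = a \<bullet> b" "q = b \<bullet> c" "u = a \<bullet> c"
  have nz: "X \<noteq> 0" "Y \<noteq> 0" "Z \<noteq> 0" using assms by (auto simp: defs)
  have "a \<noteq> 0" "b \<noteq> 0" "c \<noteq> 0" using x y z by (auto simp: cross_def)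
  then have nz': "A \<noteq> 0" "B \<noteq> 0" "C \<noteq> 0" by (auto simp: defs)
  \<comment> \<open>Addition formulas for the cotangents \<open>p / X\<close>, \<open>q / Y\<close>,
    \<open>u / Z\<close> of the angles between \<open>a\<close>, \<open>b\<close>, \<open>c\<close>,
    cleared of denominators.\<close>
  have "p * Y + q * X = Z * B" "p * Z - u * X = A * Y" "q * Z - u * Y = C * X"
    unfolding defs cross_altdef cmod_power2 inner_complex_def by algebra+
  then have B: "p / X / B = Z / (X * Y) - q / Y / B"
    and A: "p / X / A = Y / (X * Z) + u / Z / A"
    and C: "q / Y / C = X / (Y * Z) + u / Z / C"
    using nz nz' by (auto simp: divide_simps) (auto simp: algebra_simps)
  have "- ((s * s' / A + t * t' / B) * p - s * t' - t * s') / (2 * X)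
     + - ((t * t' / B + w * w' / C) * q - t * w' - w * t') / (2 * Y)
     - - ((s * s' / A + w * w' / C) * u - s * w' - w * s') / (2 * Z)
     = - (s * s' * (p / X / A) + t * t' * (p / X / B) - (s * t' + t * s') / X
       + t * t' * (q / Y / B) + w * w' * (q / Y / C) - (t * w' + w * t') / Y
       - s * s' * (u / Z / A) - w * w' * (u / Z / C) + (s * w' + w * s') / Z) / 2"
    by (simp add: add_divide_distrib diff_divide_distrib ring_distribs mult.commute)
  also have "\<dots> = - (s * s' * Y / (X * Z) + t * t' * Z / (X * Y) - (s * t' + t * s') / X
       + w * w' * X / (Y * Z) - (t * w' + w * t') / Y + (s * w' + w * s') / Z) / 2"
    unfolding A B C by (simp add: ring_distribs)
  also have "\<dots> = (- Z / (2 * X * Y)) * (t - Y / Z * s - X / Z * w) * (t' - Y / Z * s' - X / Z * w')"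
    using nz by (simp add: divide_simps) (simp add: algebra_simps)
  finally show ?thesis by (simp add: defs)
qed

section \<open>Intersection points, turning angles and tangent lines\<close>

definition meet :: "complex \<Rightarrow> complex \<Rightarrow> real \<Rightarrow> real \<Rightarrow> complex" where
  "meet a b s t = (of_real s * b - of_real t * a) / of_real (cross a b)"

lemma cross_divide_of_real: "cross a (p / of_real k) = cross a p / k"
  by (simp add: cross_altdef Re_divide_of_real Im_divide_of_real diff_divide_distrib)

lemma cross_meet:
  assumes "cross a b \<noteq> 0"
  shows "cross a (meet a b s t) = s" "cross b (meet a b s t) = t"
proof -
  have "cross a (of_real s * b - of_real t * a) = s * cross a b"
    "cross b (of_real s * b - of_real t * a) = t * cross a b"
    by (simp_all add: cross_altdef algebra_simps)
  then show "cross a (meet a b s t) = s" "cross b (meet a b s t) = t"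
    using assms by (simp_all add: meet_def cross_divide_of_real)
qed

lemma eq_meet:
  assumes "cross a b \<noteq> 0" "cross a p = s" "cross b p = t"
  shows "p = meet a b s t"
proof -
  have "of_real (cross a b) * p = of_real s * b - of_real t * a"
    unfolding assms(2,3)[symmetric] by (simp add: complex_eq_iff cross_altdef) algebra
  then show ?thesis using assms(1) by (simp add: meet_def field_simps)
qed

lemma inner_meet:
  assumes "cross a b \<noteq> 0"
  shows "a \<bullet> meet a b s t = (s * (a \<bullet> b) - t * (cmod a)\<^sup>2) / cross a b"
    and "b \<bullet> meet a b s t = (s * (cmod b)\<^sup>2 - t * (a \<bullet> b)) / cross a b"
  unfolding meet_def inner_complex_def cmod_power2
  by (simp_all add: Re_divide_of_real Im_divide_of_real
      diff_divide_distrib[symmetric] add_divide_distrib[symmetric])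
     (simp_all add: algebra_simps power2_eq_square)

lemma eq_scaleR_if_cross_zero:
  assumes "cross b p = 0" "b \<noteq> 0"
  shows "p = of_real ((b \<bullet> p) / (cmod b)\<^sup>2) * b"
proof -
  have "of_real ((cmod b)\<^sup>2) * p = of_real (b \<bullet> p) * b"
    using assms(1) unfolding cmod_power2 
    by (simp add: complex_eq_iff cross_altdef inner_complex_def) algebra
  then show ?thesis using assms(2) by (simp add: field_simps)
qed

lemma Im_divide_eq_cross: "Im (b / a) = cross a b / (cmod a)\<^sup>2"
  by (simp add: Im_divide cross_altdef cmod_power2 mult.commute)

lemma Arg_divide_bounds:
  assumes "cross a b \<noteq> 0"
  shows "- pi < Arg (b / a)" "Arg (b / a) < pi" "Arg (b / a) \<noteq> 0"
    "Arg (b / a) < 0 \<longleftrightarrow> cross a b < 0"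
proof -
  have "a \<noteq> 0" using assms by (auto simp: cross_def)
  then have *: "Im (b / a) \<noteq> 0" "Im (b / a) < 0 \<longleftrightarrow> cross a b < 0"
    using assms by (auto simp: Im_divide_eq_cross divide_less_0_iff)
  then have "Arg (b / a) \<noteq> pi" using Arg_eq_pi by blast
  then show "- pi < Arg (b / a)" "Arg (b / a) < pi" 
    using mpi_less_Arg[of "b / a"] Arg_le_pi[of "b / a"] by auto
  show "Arg (b / a) \<noteq> 0" using * Arg_eq_0[of "b / a"] by (auto simp: complex_is_Real_iff)
  show "Arg (b / a) < 0 \<longleftrightarrow> cross a b < 0" using * Arg_neg_iff by blast
qed

text \<open>With \<open>p\<close> in the role of pi: the sum has to be shifted only if
  \<open>\<alpha>\<close> and \<open>\<beta>\<close> have the same sign, and then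
  \<open>\<gamma>\<close> has the opposite one. Without a shift only the signs matter.\<close>

lemma angle_sum_sign_count:
  fixes p \<alpha> \<beta> \<gamma> :: real
  assumes "- p < \<alpha>" "\<alpha> < p" "\<alpha> \<noteq> 0" "- p < \<beta>" "\<beta> < p" "\<beta> \<noteq> 0" "- p < \<gamma>" "\<gamma> < p" "\<gamma> \<noteq> 0"
    and \<gamma>: "\<gamma> = \<alpha> + \<beta> + (if \<alpha> + \<beta> \<in> {-p<..p} then 0 else if \<alpha> + \<beta> > p then -2 else 2) * p"
  shows "of_bool (\<alpha> < 0) + of_bool (\<beta> < 0) - of_bool (\<gamma> < 0)
      - (if \<alpha> + \<beta> \<in> {-p<..p} then 0 else if \<alpha> + \<beta> > p then -2 else 2)
      = (of_bool (\<gamma> < 0 \<longleftrightarrow> (\<alpha> < 0 \<longleftrightarrow> \<beta> < 0)) :: real)"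
proof -
  consider "\<alpha> + \<beta> > p" | "\<alpha> + \<beta> \<le> -p" | "-p < \<alpha> + \<beta>" "\<alpha> + \<beta> \<le> p" by linarith
  then show ?thesis
  proof cases
    case 1
    then have "\<gamma> = \<alpha> + \<beta> - 2 * p" "\<alpha> > 0" "\<beta> > 0" using assms by auto
    then show ?thesis using 1 assms(1-9) by simp
  next
    case 2
    then have "\<gamma> = \<alpha> + \<beta> + 2 * p" "\<alpha> < 0" "\<beta> < 0" using assms by auto
    then show ?thesis using 2 assms(1-9) by simp
  next
    case 3
    then have "\<gamma> = \<alpha> + \<beta>" using assms by auto
    then show ?thesis using 3 assms(1-9)
      by (cases "\<alpha> < 0"; cases "\<beta> < 0"; cases "\<gamma> < 0") simp_all
  qed
qed

text \<open>\<open>Arg\<close> is additive up to a multiple of 2 pi, which the count of right turns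
  compensates up to 0 or 1. With \<open>d (m - 1)\<close>, \<open>d m\<close>, \<open>d 0\<close>
  for \<open>a\<close>, \<open>b\<close>, \<open>c\<close> the fraction on the right is
  \<open>fan_coef d m\<close>.\<close>

lemma turn_cocycle:
  assumes "cross a b \<noteq> 0" "cross b c \<noteq> 0" "cross a c \<noteq> 0"
  shows "of_bool (cross a b < 0) + of_bool (cross b c < 0) - of_bool (cross a c < 0)
     + (Arg (b / a) + Arg (c / b) - Arg (c / a)) / pi
     = (of_bool (0 < - cross a c / (2 * cross a b * cross b c)) :: real)"
proof -
  have nz: "a \<noteq> 0" "b \<noteq> 0" "c \<noteq> 0" using assms by (auto simp: cross_def)
  note bounds = Arg_divide_bounds[OF assms(1)] Arg_divide_bounds[OF assms(2)]
    Arg_divide_bounds[OF assms(3)]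
  define \<epsilon> :: real where "\<epsilon> = (if Arg (b / a) + Arg (c / b) \<in> {-pi<..pi} then 0
     else if Arg (b / a) + Arg (c / b) > pi then -2 else 2)"
  have "(b / a) * (c / b) = c / a" using nz by simp
  then have Arg: "Arg (c / a) = Arg (b / a) + Arg (c / b) + \<epsilon> * pi"
    using Arg_times'[of "b / a" "c / b"] nz unfolding \<epsilon>_def by auto
  have "(Arg (b / a) + Arg (c / b) - Arg (c / a)) / pi = - \<epsilon>"
    unfolding Arg by simp
  moreover have "0 < - cross a c / (2 * cross a b * cross b c) \<longleftrightarrow>
      (cross a c < 0 \<longleftrightarrow> (cross a b < 0 \<longleftrightarrow> cross b c < 0))"
    using assms by (auto simp: zero_less_divide_iff divide_less_0_iff zero_less_mult_iff mult_less_0_iff)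
  ultimately show ?thesis
    using angle_sum_sign_count[OF bounds(1-3,5-7,9-11) Arg[unfolded \<epsilon>_def]]
    unfolding bounds(4,8,12) \<epsilon>_def by simp
qed

text \<open>Both lines have distance \<open>\<bar>r\<bar>\<close> from the origin, so they meet on a
  bisector of their normals: the normal \<open>\<i> * sgn a\<close> turned by half the turning
  angle.\<close>

lemma meet_tangents:
  fixes r :: real
  assumes "cross a b \<noteq> 0"
  shows "meet a b (- (r * cmod a)) (- (r * cmod b)) =
     of_real (- r / cos (Arg (b / a) / 2)) * (\<i> * sgn a * cis (Arg (b / a) / 2))"
proof -
  define \<theta> where "\<theta> = Arg (b / a)"
  define \<rho> where "\<rho> = - r / cos (\<theta> / 2)"
  have nz: "a \<noteq> 0" "b \<noteq> 0" using assms by (auto simp: cross_def)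
  have "cos (\<theta> / 2) > 0"
    using Arg_divide_bounds[OF assms] by (intro cos_gt_zero_pi) (auto simp: \<theta>_def)
  then have \<rho>: "\<rho> * cos (\<theta> / 2) = - r" by (simp add: \<rho>_def)
  have a: "a = of_real (cmod a) * sgn a" using nz by (simp add: sgn_div_norm scaleR_conv_of_real)
  have b: "b = of_real (cmod b) * (sgn a * cis \<theta>)"
  proof -
    have "b = a * (b / a)" using nz by simp
    also have "b / a = of_real (cmod b / cmod a) * cis \<theta>"
      using rcis_cmod_Arg[of "b / a"] by (simp add: rcis_def \<theta>_def norm_divide)
    also have "a * \<dots> = of_real (cmod b) * (sgn a * cis \<theta>)"
      using nz by (simp add: sgn_div_norm scaleR_conv_of_real divide_inverse mult_ac)
    finally show ?thesis .
  qed
  have unit: "cnj (sgn a) * sgn a = 1"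
    using nz by (simp add: mult.commute[of "cnj _"] complex_norm_square[symmetric] norm_sgn)
  have "cnj a * (of_real \<rho> * (\<i> * sgn a * cis (\<theta> / 2)))
      = of_real (cmod a * \<rho>) * (\<i> * cis (\<theta> / 2)) * (cnj (sgn a) * sgn a)"
    by (subst (1) a) (simp add: mult_ac)
  then have "cross a (of_real \<rho> * (\<i> * sgn a * cis (\<theta> / 2))) = cmod a * \<rho> * cos (\<theta> / 2)"
    unfolding cross_def by (simp only: unit) simp
  then have "cross a (of_real \<rho> * (\<i> * sgn a * cis (\<theta> / 2))) = - (r * cmod a)"
    using \<rho> by (simp add: mult.assoc)
  moreover
  have "cis (- \<theta>) * cis (\<theta> / 2) = cis (- (\<theta> / 2))" by (simp add: cis_mult)
  then have "cnj b * (of_real \<rho> * (\<i> * sgn a * cis (\<theta> / 2)))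
      = of_real (cmod b * \<rho>) * (\<i> * cis (- (\<theta> / 2))) * (cnj (sgn a) * sgn a)"
    by (subst (1) b) (simp add: mult_ac cis_cnj)
  then have "cross b (of_real \<rho> * (\<i> * sgn a * cis (\<theta> / 2))) = cmod b * \<rho> * cos (\<theta> / 2)"
    unfolding cross_def by (simp only: unit) simp
  then have "cross b (of_real \<rho> * (\<i> * sgn a * cis (\<theta> / 2))) = - (r * cmod b)"
    using \<rho> by (simp add: mult.assoc)
  ultimately show ?thesis
    using eq_meet[OF assms] unfolding \<theta>_def \<rho>_def by metis
qed

text \<open>By \<open>meet_tangents\<close> the ratio is a positive real times a rotation by the
  mean of the two turning angles. That mean lies strictly between -pi and pi, so \<open>Arg\<close>
  returns it unshifted.\<close>

lemma Arg_meet_tangents_ratio: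
  fixes r :: real
  assumes "cross a b \<noteq> 0" "cross b c \<noteq> 0" "r \<noteq> 0"
  shows "Arg (meet b c (- (r * cmod b)) (- (r * cmod c)) / meet a b (- (r * cmod a)) (- (r * cmod b)))
     = (Arg (b / a) + Arg (c / b)) / 2"
proof -
  define \<theta> \<theta>' where "\<theta> = Arg (b / a)" and "\<theta>' = Arg (c / b)"
  have nz: "a \<noteq> 0" "b \<noteq> 0" using assms by (auto simp: cross_def)
  have range: "- pi < \<theta>" "\<theta> < pi" "- pi < \<theta>'" "\<theta>' < pi"
    using Arg_divide_bounds[OF assms(1)] Arg_divide_bounds[OF assms(2)] by (auto simp: \<theta>_def \<theta>'_def)
  then have cos: "cos (\<theta> / 2) > 0" "cos (\<theta>' / 2) > 0"
    by (auto intro!: cos_gt_zero_pi)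
  have "sgn b = sgn a * cis \<theta>"
  proof -
    have "sgn b = sgn a * sgn (b / a)"
      using nz by (simp add: sgn_divide sgn_zero_iff)
    also have "sgn (b / a) = cis \<theta>" using nz cis_Arg[of "b / a"] by (simp add: \<theta>_def)
    finally show ?thesis .
  qed
  moreover have "of_real (- r / k') * (\<i> * (u * v) * w') / (of_real (- r / k) * (\<i> * u * w))
     = of_real (k / k') * (v * w' / w)" if "u \<noteq> 0" for u v w w' :: complex and k k' :: real
    using that assms(3) by simp
  ultimately have "meet b c (- (r * cmod b)) (- (r * cmod c)) / meet a b (- (r * cmod a)) (- (r * cmod b))
     = of_real (cos (\<theta> / 2) / cos (\<theta>' / 2)) * (cis \<theta> * cis (\<theta>' / 2) / cis (\<theta> / 2))"
    unfolding meet_tangents[OF assms(1)] meet_tangents[OF assms(2)]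
    using nz by (simp only: \<theta>_def[symmetric] \<theta>'_def[symmetric] sgn_zero_iff not_False_eq_True)
  also have "\<dots> = rcis (cos (\<theta> / 2) / cos (\<theta>' / 2)) ((\<theta> + \<theta>') / 2)"
    by (simp add: rcis_def cis_mult cis_divide diff_divide_distrib add_divide_distrib)
  finally show ?thesis
    using range cos unfolding \<theta>_def[symmetric] \<theta>'_def[symmetric]
    by (intro Arg_unique'[of "cos (\<theta> / 2) / cos (\<theta>' / 2)"]) auto
qed

lemma infdist_eline:
  assumes "d i \<noteq> 0"
  shows "infdist X (eline d h i) = \<bar>cross (d i) X - h i\<bar> / cmod (d i)"
proof -
  define c where "c = cross (d i) X - h i"
  \<comment> \<open>The foot of the perpendicular from \<open>X\<close> on the line.\<close>
  define p where "p = X - of_real (c / (cmod (d i))\<^sup>2) * (\<i> * d i)"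
  have "cross (d i) p = cross (d i) X - c / (cmod (d i))\<^sup>2 * (cmod (d i))\<^sup>2"
    unfolding p_def cross_altdef cmod_power2 
    by (simp add: ring_distribs power2_eq_square mult_ac add_divide_distrib)
  then have p: "p \<in> eline d h i" using assms by (simp add: eline_def c_def)
  have "dist X p = \<bar>c\<bar> / cmod (d i)"
    using assms by (simp add: p_def dist_norm norm_mult norm_divide power2_eq_square)
  then have le: "infdist X (eline d h i) \<le> \<bar>c\<bar> / cmod (d i)"
    using infdist_le[OF p, of X] by simp
  have "\<bar>c\<bar> / cmod (d i) \<le> dist X q" if "q \<in> eline d h i" for q
  proof -
    have "c = cross (d i) (X - q)"
      using that by (simp add: c_def eline_def cross_altdef algebra_simps)
    also have "\<bar>\<dots>\<bar> \<le> cmod (d i) * cmod (X - q)"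
      unfolding cross_def using abs_Im_le_cmod[of "cnj (d i) * (X - q)"] by (simp add: norm_mult)
    finally show ?thesis using assms by (simp add: dist_norm field_simps)
  qed
  then have "\<bar>c\<bar> / cmod (d i) \<le> infdist X (eline d h i)"
    using p unfolding infdist_def by (auto intro!: cINF_greatest)
  then show ?thesis using le by (simp add: c_def)
qed

section \<open>Polygons with fixed slopes\<close>

locale slopes =
  fixes n :: nat and d :: "nat \<Rightarrow> complex"
  assumes n_ge_2: "2 \<le> n"
    and not_parallel: "i < n \<Longrightarrow> j < n \<Longrightarrow> i \<noteq> j \<Longrightarrow> cross (d i) (d j) \<noteq> 0"
begin

lemma d_nonzero: "i < n \<Longrightarrow> d i \<noteq> 0"
  using not_parallel[of i "if i = 0 then 1 else 0"] n_ge_2 by (cases "i = 0") (auto simp: cross_def)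

lemma mod_less_n [simp]: "i mod n < n"
  using n_ge_2 by simp

lemma Suc_mod_neq: "i mod n \<noteq> Suc i mod n"
  using n_ge_2 by (auto simp: mod_Suc)

lemma cross_Suc_nonzero: "cross (d (i mod n)) (d (Suc i mod n)) \<noteq> 0"
  by (intro not_parallel Suc_mod_neq) auto

lemma cross_fan_nonzero:
  assumes "m \<in> {2..<n}"
  shows "cross (d (m - 1)) (d m) \<noteq> 0" "cross (d m) (d 0) \<noteq> 0" "cross (d (m - 1)) (d 0) \<noteq> 0"
  using assms by (intro not_parallel; auto)+

lemma fan_coef_nonzero: "m \<in> {2..<n} \<Longrightarrow> fan_coef d m \<noteq> 0"
  using cross_fan_nonzero[of m] by (simp add: fan_coef_def)

lemma cyclic_edge_form: "(\<Sum>i<n. edge_form d h h' i (Suc i mod n)) = area_form n d h h'"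
proof -
  \<comment> \<open>\<open>edge_form\<close> is antisymmetric in its two indices, so the two-sided
    term of the fan sum drops out.\<close>
  have "edge_form d h h' 0 1 + edge_form d h h' 1 0 = 0"
    unfolding edge_form_def cross_commute[of "d 1" "d 0"] by (simp add: inner_commute algebra_simps)
  moreover have "edge_form d h h' (m - 1) m + edge_form d h h' m 0 - edge_form d h h' (m - 1) 0
      = fan_coef d m * fan_height d m h * fan_height d m h'" if "m \<in> {2..<n}" for m
    unfolding edge_form_def fan_coef_def fan_height_def
    using edge_form_cocycle[OF cross_fan_nonzero[OF that]] .
  ultimately show ?thesis
    using cyclic_sum_eq_fan_sum[OF n_ge_2, of "edge_form d h h'"] by (simp add: area_form_def)
qed

lemma vert_eq_meet:
  "vert n d h i = meet (d (i mod n)) (d (Suc i mod n)) (h (i mod n)) (h (Suc i mod n))"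
  unfolding vert_def eline_def
  by (rule the_equality)
     (auto simp: cross_meet[OF cross_Suc_nonzero] intro!: eq_meet cross_Suc_nonzero)

text \<open>The signed length of the side on \<open>e_(i+1)\<close>, in units of the length of its
  direction vector.\<close>

definition side :: "(nat \<Rightarrow> real) \<Rightarrow> nat \<Rightarrow> real" where
  "side h i = d (Suc i mod n) \<bullet> (vert n d h (Suc i) - vert n d h i) / (cmod (d (Suc i mod n)))\<^sup>2"

lemma cross_vert:
  "cross (d (i mod n)) (vert n d h i) = h (i mod n)"
  "cross (d (Suc i mod n)) (vert n d h i) = h (Suc i mod n)"
  unfolding vert_eq_meet using cross_meet[OF cross_Suc_nonzero] by auto

lemma vert_diff: "vert n d h (Suc i) - vert n d h i = of_real (side h i) * d (Suc i mod n)"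
  unfolding side_def
  using cross_vert[of i h] cross_vert[of "Suc i" h]
  by (intro eq_scaleR_if_cross_zero d_nonzero) (auto simp: cross_altdef algebra_simps)

text \<open>Up to sign this is the first variation of the area. Each side is split at the foot of
  the perpendicular from the origin, and the pieces are regrouped by vertices.\<close>

lemma sum_side: "(\<Sum>i<n. side h i * h' (Suc i mod n)) = - 2 * area_form n d h h'"
proof -
  \<comment> \<open>\<open>F i\<close> and \<open>G i\<close> are the weighted contributions of the
    vertex \<open>v_i\<close> to the sides on \<open>e_(i+1)\<close> and on
    \<open>e_i\<close>.\<close>
  define F where "F i = h' (Suc i mod n) * (h (Suc i mod n) * (d (i mod n) \<bullet> d (Suc i mod n))
      / (cmod (d (Suc i mod n)))\<^sup>2 - h (i mod n)) / cross (d (i mod n)) (d (Suc i mod n))" for i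
  define G where "G i = h' (i mod n) * (h (i mod n) * (d (i mod n) \<bullet> d (Suc i mod n))
      / (cmod (d (i mod n)))\<^sup>2 - h (Suc i mod n)) / cross (d (i mod n)) (d (Suc i mod n))" for i
  have "side h i * h' (Suc i mod n) = F i + G (Suc i)" for i
  proof -
    have nz: "(cmod (d (Suc i mod n)))\<^sup>2 \<noteq> 0" using d_nonzero[of "Suc i mod n"] by simp
    have *: "(x - y) / k * g = g * (y' / k - z') / e + g * (y'' / k - z'') / e'"
      if "x = (y'' - z'' * k) / e'" "y = (z' * k - y') / e" "k \<noteq> 0" for x y y' z' y'' z'' k e e' g :: real
      using that(3) unfolding that(1,2) by (simp add: diff_divide_distrib ring_distribs mult.commute)
    show ?thesis
      unfolding side_def inner_diff_right F_def G_def
      by (rule *) (simp_all add: vert_eq_meet inner_meet[OF cross_Suc_nonzero] nz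
         d_nonzero)
  qed
  then have "(\<Sum>i<n. side h i * h' (Suc i mod n)) = (\<Sum>i<n. F i) + (\<Sum>i<n. G (Suc i))"
    by (simp add: sum.distrib)
  also have "(\<Sum>i<n. G (Suc i)) = (\<Sum>i<n. G (Suc i mod n))"
    by (rule sum.cong) (simp_all add: G_def mod_Suc_eq)
  also have "\<dots> = (\<Sum>i<n. G i)" by (rule sum_cyclic_shift)
  also have "(\<Sum>i<n. F i) + (\<Sum>i<n. G i) = (\<Sum>i<n. -2 * edge_form d h h' i (Suc i mod n))"
    unfolding sum.distrib[symmetric]
  proof (rule sum.cong)
    fix i assume "i \<in> {..<n}"
    moreover have "t' * (t * p / B - s) / c + s' * (s * p / A - t) / c
        = - 2 * (- ((s * s' / A + t * t' / B) * p - s * t' - t * s') / (2 * c))"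
      for s t s' t' p A B c :: real
      by (simp add: add_divide_distrib diff_divide_distrib ring_distribs mult_ac)
    ultimately show "F i + G i = -2 * edge_form d h h' i (Suc i mod n)"
      unfolding F_def G_def edge_form_def by simp
  qed simp
  also have "\<dots> = -2 * area_form n d h h'"
    unfolding sum_distrib_left[symmetric] cyclic_edge_form by simp
  finally show ?thesis .
qed

lemma area_eq: "area n d h = area_form n d h h"
proof -
  have "Re (vert n d h i) * Im (vert n d h (Suc i)) - Re (vert n d h (Suc i)) * Im (vert n d h i)
      = - (side h i * h (Suc i mod n))" for i
  proof -
    have "vert n d h (Suc i) = vert n d h i + of_real (side h i) * d (Suc i mod n)"
      using vert_diff[of h i] by (simp add: algebra_simps)
    then show ?thesis
      unfolding cross_vert(2)[of i h, symmetric] cross_altdef by (simp add: algebra_simps)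
  qed
  then show ?thesis unfolding area_def by (simp add: sum_negf sum_side)
qed

text \<open>The weights \<open>cmod (d i)\<close> convert \<open>side\<close> into signed lengths.
  As offsets they describe lines tangent to the unit circle about the origin, which lies to their
  right.\<close>

lemma perim_eq: "perim n d h = -2 * area_form n d h (\<lambda>i. cmod (d i))"
proof -
  have "(if \<exists>t::real\<ge>0. vert n d h (Suc i) - vert n d h i = of_real t * d (Suc i mod n) then 1 else -1)
       * cmod (vert n d h (Suc i) - vert n d h i) = side h i * cmod (d (Suc i mod n))" for i
  proof -
    have "(\<exists>t::real\<ge>0. of_real (side h i) * d (Suc i mod n) = of_real t * d (Suc i mod n))
        \<longleftrightarrow> side h i \<ge> 0"
      using d_nonzero[of "Suc i mod n"] by auto
    then show ?thesis unfolding vert_diff by (simp add: norm_mult)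
  qed
  then show ?thesis unfolding perim_def using sum_side[of h "\<lambda>i. cmod (d i)"] by simp
qed

text \<open>These are the offsets of lines through the common point \<open>X\<close>; adding them to
  other offsets translates the polygon by \<open>X\<close>.\<close>

lemma fan_height_translation:
  assumes "m \<in> {2..<n}"
  shows "fan_height d m (\<lambda>i. cross (d i) X) = 0"
proof -
  have "cross (d (m - 1)) (d 0) * cross (d m) X =
     cross (d m) (d 0) * cross (d (m - 1)) X + cross (d (m - 1)) (d m) * cross (d 0) X"
    unfolding cross_altdef by algebra
  then show ?thesis
    unfolding fan_height_def using cross_fan_nonzero(3)[OF assms]
    by (simp add: eq_divide_eq diff_divide_distrib[symmetric] divide_simps mult_ac)
qed

lemma offset_if_incircle:
  assumes "is_incircle n d h X r" "i < n"
  shows "h i = cross (d i) X - r * cmod (d i)"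
proof -
  have "\<bar>cross (d i) X - h i\<bar> = \<bar>r\<bar> * cmod (d i)"
    using assms infdist_eline[of d i X h] d_nonzero[OF assms(2)]
    by (simp add: is_incircle_def field_simps)
  moreover have "r > 0 \<Longrightarrow> cross (d i) X - h i > 0" "r < 0 \<Longrightarrow> cross (d i) X - h i < 0" "r \<noteq> 0"
    using assms by (auto simp: is_incircle_def)
  ultimately show ?thesis by (cases "r > 0") auto
qed

text \<open>Seen from the center, the step from one vertex to the next is the mean of two
  consecutive turning angles; around the polygon every turning angle is counted twice with weight
  one half.\<close>

lemma winding_poly_eq:
  assumes "is_incircle n d h X r"
  shows "winding_poly n d h X = (\<Sum>i<n. Arg (d (Suc i mod n) / d i)) / (2 * pi)"
proof -
  have r: "r \<noteq> 0" using assms by (simp add: is_incircle_def)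
  define \<theta> where "\<theta> i = Arg (d (Suc i mod n) / d (i mod n))" for i
  have vX: "vert n d h i - X = meet (d (i mod n)) (d (Suc i mod n))
      (- (r * cmod (d (i mod n)))) (- (r * cmod (d (Suc i mod n))))" for i
    using cross_vert[of i h] offset_if_incircle[OF assms, of "i mod n"]
      offset_if_incircle[OF assms, of "Suc i mod n"]
    by (intro eq_meet cross_Suc_nonzero) (auto simp: cross_altdef algebra_simps)
  have "(\<Sum>i<n. Arg ((vert n d h (Suc i) - X) / (vert n d h i - X))) = (\<Sum>i<n. (\<theta> i + \<theta> (Suc i mod n)) / 2)"
    unfolding vX Arg_meet_tangents_ratio[OF cross_Suc_nonzero cross_Suc_nonzero r]
    by (simp add: \<theta>_def mod_Suc_eq)
  also have "\<dots> = ((\<Sum>i<n. \<theta> i) + (\<Sum>i<n. \<theta> (Suc i mod n))) / 2"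
    by (simp add: sum.distrib sum_divide_distrib[symmetric])
  also have "\<dots> = (\<Sum>i<n. \<theta> i)" using sum_cyclic_shift[of \<theta> n] by simp
  also have "\<dots> = (\<Sum>i<n. Arg (d (Suc i mod n) / d i))"
    by (rule sum.cong) (auto simp: \<theta>_def)
  finally show ?thesis by (simp add: winding_poly_def)
qed

text \<open>The fan sum of right turns plus turning angles over pi, with \<open>turn_cocycle\<close>
  evaluating each triangle.\<close>

lemma card_fan_coef_pos:
  "real (card {m \<in> {2..<n}. 0 < fan_coef d m}) =
     real (RT n d) - 1 + (\<Sum>i<n. Arg (d (Suc i mod n) / d i)) / pi"
proof -
  define \<phi> where "\<phi> i j = of_bool (cross (d i) (d j) < 0) + Arg (d j / d i) / pi" for i j
  have RT: "RT n d = card ({..<n} \<inter> {i. cross (d i) (d (Suc i mod n)) < 0})"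
    unfolding RT_def by (rule arg_cong[of _ _ card]) auto
  have "real (RT n d) + (\<Sum>i<n. Arg (d (Suc i mod n) / d i)) / pi = (\<Sum>i<n. \<phi> i (Suc i mod n))"
    unfolding \<phi>_def sum.distrib sum_divide_distrib[symmetric] RT
    by simp
  also have "\<dots> = \<phi> 0 1 + \<phi> 1 0 + (\<Sum>m=2..<n. \<phi> (m - 1) m + \<phi> m 0 - \<phi> (m - 1) 0)"
    using cyclic_sum_eq_fan_sum[OF n_ge_2] .
  \<comment> \<open>Of two opposite turns exactly one is a right turn, and their angles cancel; this
    accounts for the \<open>- 1\<close> in the formula.\<close>
  also have "\<phi> 0 1 + \<phi> 1 0 = 1"
  proof -
    have nz: "cross (d 0) (d 1) \<noteq> 0" using not_parallel[of 0 1] n_ge_2 by auto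
    then have "Im (d 1 / d 0) \<noteq> 0"
      unfolding Im_divide_eq_cross using d_nonzero[of 0] n_ge_2 by simp
    then have "Arg (d 0 / d 1) = - Arg (d 1 / d 0)"
      using Arg_inverse[of "d 1 / d 0"] by (simp add: complex_is_Real_iff)
    then show ?thesis using nz cross_commute[of "d 1" "d 0"] by (auto simp: \<phi>_def)
  qed
  also have "(\<Sum>m=2..<n. \<phi> (m - 1) m + \<phi> m 0 - \<phi> (m - 1) 0) = (\<Sum>m=2..<n. of_bool (0 < fan_coef d m))"
  proof (rule sum.cong)
    fix m assume "m \<in> {2..<n}"
    from turn_cocycle[OF cross_fan_nonzero[OF this]]
    show "\<phi> (m - 1) m + \<phi> m 0 - \<phi> (m - 1) 0 = of_bool (0 < fan_coef d m)"
      unfolding fan_coef_def[of d m, symmetric] by (simp add: \<phi>_def add_divide_distrib diff_divide_distrib)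
  qed simp
  also have "\<dots> = real (card ({2..<n} \<inter> {m. 0 < fan_coef d m}))" by simp
  also have "{2..<n} \<inter> {m. 0 < fan_coef d m} = {m \<in> {2..<n}. 0 < fan_coef d m}" by auto
  finally show ?thesis by simp
qed

lemma RT_plus_LT: "RT n d + LT n d = n"
proof -
  define R L where "R = {i. i < n \<and> cross (d i) (d (Suc i mod n)) < 0}"
    and "L = {i. i < n \<and> cross (d i) (d (Suc i mod n)) > 0}"
  have "cross (d i) (d (Suc i mod n)) \<noteq> 0" if "i < n" for i
    using cross_Suc_nonzero[of i] that by simp
  then have "R \<union> L = {..<n}"
    unfolding R_def L_def by (auto simp: linorder_neq_iff)
  moreover have "R \<inter> L = {}" "finite R" "finite L" by (auto simp: R_def L_def)
  ultimately have "card R + card L = card {..<n}" using card_Un_disjoint[of R L] by simp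
  then show ?thesis by (simp add: RT_def LT_def R_def L_def)
qed

end

section \<open>The area form on the space of offsets, and the index formula\<close>

lemma fan_height_add: "fan_height d m (\<lambda>i. h i + h' i) = fan_height d m h + fan_height d m h'"
  by (simp add: fan_height_def ring_distribs)

lemma fan_height_scale: "fan_height d m (\<lambda>i. c * h i) = c * fan_height d m h"
  by (simp add: fan_height_def ring_distribs mult_ac)

text \<open>Placing \<open>v_0\<close> at the origin selects one polygon from each translation
  class.\<close>

definition pinned :: "(nat \<Rightarrow> 'n) \<Rightarrow> (real^'n::finite) set" where
  "pinned ix = {y. y $ ix 0 = 0 \<and> y $ ix 1 = 0}"

text \<open>The heights are triangular in the offsets: \<open>fan_height d m\<close> is the
  \<open>m\<close>-th offset minus a combination of earlier ones. With the first two offsets fixed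
  at 0, the others are determined recursively.\<close>

lemma diagonal_form_fan:
  fixes d :: "nat \<Rightarrow> complex" and ix :: "nat \<Rightarrow> 'n::finite"
  assumes "slopes CARD('n) d" and ix: "bij_betw ix {..<CARD('n)} UNIV" and s: "s \<noteq> 0"
  shows "diagonal_form {2..<CARD('n)} (\<lambda>m. s * fan_coef d m)
    (\<lambda>m y. fan_height d m (offs ix y)) (pinned ix)"
proof (rule diagonal_form.intro)
  interpret slopes "CARD('n)" d by fact
  show "subspace (pinned ix)" by (auto simp: subspace_def pinned_def)
  show "linear (\<lambda>y. fan_height d m (offs ix y))" for m
  proof (rule linearI)
    have "offs ix (y + z) = (\<lambda>i. offs ix y i + offs ix z i)" for y z by (auto simp: offs_def)
    then show "fan_height d m (offs ix (y + z)) = fan_height d m (offs ix y) + fan_height d m (offs ix z)"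
      for y z by (simp add: fan_height_add)
    have "offs ix (c *\<^sub>R y) = (\<lambda>i. c * offs ix y i)" for c y by (auto simp: offs_def)
    then show "fan_height d m (offs ix (c *\<^sub>R y)) = c *\<^sub>R fan_height d m (offs ix y)" for c y
      by (simp add: fan_height_scale)
  qed
  show "s * fan_coef d m \<noteq> 0" if "m \<in> {2..<CARD('n)}" for m
    using s fan_coef_nonzero[OF that] by simp
  show "\<exists>y\<in>pinned ix. \<forall>m\<in>{2..<CARD('n)}. fan_height d m (offs ix y) = c m" for c
  proof -
    \<comment> \<open>The offsets that solve \<open>fan_height = c m\<close> one index at a time;
      the case \<open>j = 0\<close> sets the pinned value \<open>k 1 = 0\<close>.\<close>
    define k where "k = rec_nat 0 (\<lambda>j t. if j = 0 then 0 else
       c (Suc j) + cross (d (Suc j)) (d 0) / cross (d j) (d 0) * t)"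
    have k: "k 0 = 0" "k (Suc 0) = 0"
      "\<And>j. j \<noteq> 0 \<Longrightarrow> k (Suc j) = c (Suc j) + cross (d (Suc j)) (d 0) / cross (d j) (d 0) * k j"
      by (simp_all add: k_def)
    define y :: "real^'n" where "y = (\<chi> j. k (inv_into {..<CARD('n)} ix j))"
    have y: "y $ ix i = k i" if "i < CARD('n)" for i
      using that bij_betw_inv_into_left[OF ix, of i] by (simp add: y_def)
    have "y \<in> pinned ix" using y[of 0] y[of 1] n_ge_2 k by (simp add: pinned_def)
    moreover have "fan_height d m (offs ix y) = c m" if m: "m \<in> {2..<CARD('n)}" for m
    proof -
      obtain j where "m = Suc j" "j \<noteq> 0" using m by (cases m) auto
      then show ?thesis
        using m y[of m] y[of j] y[of 0] k(1) k(3)[of j] by (simp add: fan_height_def offs_def)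
    qed
    ultimately show ?thesis by blast
  qed
  show "y = 0" if y: "y \<in> pinned ix"
    and zero: "\<And>m. m \<in> {2..<CARD('n)} \<Longrightarrow> fan_height d m (offs ix y) = 0" for y
  proof -
    have "y $ ix i = 0" if "i < CARD('n)" for i
      using that
    proof (induction i)
      case (Suc j)
      show ?case
      proof (cases "j = 0")
        case False
        then show ?thesis
          using Suc zero[of "Suc j"] y by (simp add: fan_height_def offs_def pinned_def)
      qed (use y in \<open>simp add: pinned_def\<close>)
    qed (use y in \<open>simp add: pinned_def\<close>)
    moreover have "\<exists>i<CARD('n). j = ix i" for j
      using ix by (force simp: bij_betw_def)
    ultimately show ?thesis by (metis vec_eq_iff zero_index)
  qed
qed simp

text \<open>Tangency is stated as an equation for the offsets, so that the lemma applies to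
  \<open>Q\<close> and \<open>-Q\<close> alike, whatever the sign of \<open>r\<close>.\<close>

lemma tangential_polygon:
  fixes d :: "nat \<Rightarrow> complex" and ix :: "nat \<Rightarrow> 'n::finite"
  assumes "slopes CARD('n) d" and ix: "bij_betw ix {..<CARD('n)} UNIV"
    and x: "x \<in> polyS d ix" and r: "r \<noteq> 0"
    and tangent: "\<And>i. i < CARD('n) \<Longrightarrow> offs ix x i = cross (d i) X - r * cmod (d i)"
  shows "nondeg_critical_point (perimF d ix) (polyS d ix) x"
    and "morse_index (perimF d ix) (polyS d ix) x + (if 0 < perimF d ix x then 1 else 0)
       = card {m \<in> {2..<CARD('n)}. 0 < r * fan_coef d m}"
    and "perimF d ix x \<noteq> 0"
proof -
  interpret slopes "CARD('n)" d by fact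
  \<comment> \<open>The factor \<open>2 / r\<close> makes the perimeter equal to \<open>B x\<close>;
    the level parameter \<open>r / 2\<close> below turns \<open>B\<close> back into the
    area.\<close>
  interpret diagonal_form "{2..<CARD('n)}" "\<lambda>m. 2 / r * fan_coef d m"
    "\<lambda>m y. fan_height d m (offs ix y)" "pinned ix"
    using r by (intro diagonal_form_fan assms) simp
  have B: "B u v = 2 / r * area_form CARD('n) d (offs ix u) (offs ix v)" for u v
    unfolding B_def area_form_def sum_distrib_left by (rule sum.cong) simp_all
  have "fan_height d m (offs ix x) = - r * fan_height d m (\<lambda>i. cmod (d i))"
    if m: "m \<in> {2..<CARD('n)}" for m
  proof -
    have "fan_height d m (offs ix x) = fan_height d m (\<lambda>i. cross (d i) X + - r * cmod (d i))"
    proof -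
      have "m < CARD('n)" "m - 1 < CARD('n)" "0 < CARD('n)" using m by auto
      from this[THEN tangent] show ?thesis unfolding fan_height_def by simp
    qed
    then show ?thesis
      unfolding fan_height_add fan_height_scale fan_height_translation[OF m] by simp
  qed
  then have "area_form CARD('n) d (offs ix x) h = - r * area_form CARD('n) d (\<lambda>i. cmod (d i)) h" for h
    unfolding area_form_def sum_distrib_left by (intro sum.cong) (simp_all only: mult_ac)
  moreover have "area_form CARD('n) d (\<lambda>i. cmod (d i)) h = area_form CARD('n) d h (\<lambda>i. cmod (d i))" for h
    unfolding area_form_def by (intro sum.cong) (simp_all only: mult_ac)
  ultimately have "B x y = perimF d ix y" for y
    unfolding B perimF_def perim_eq using r by simp
  then have f: "perimF d ix = B x" by (intro ext) (rule sym)
  have "\<bar>r / 2 * B y y\<bar> = 1 \<longleftrightarrow> \<bar>area CARD('n) d (offs ix y)\<bar> = 1" for y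
    unfolding B area_eq using r by simp
  moreover have "polyS d ix = {y \<in> pinned ix. \<bar>area CARD('n) d (offs ix y)\<bar> = 1}"
    by (simp add: polyS_def pinned_def)
  ultimately have M: "polyS d ix = level_set (r / 2)"
    by (simp only: level_set_def)
  have xM: "x \<in> level_set (r / 2)" using x M by simp
  show "nondeg_critical_point (perimF d ix) (polyS d ix) x"
    unfolding f M using xM by (rule nondeg_critical_point_level_set)
  have "0 < 2 / r * c \<longleftrightarrow> 0 < r * c" for c :: real
    using r by (auto simp: zero_less_mult_iff zero_less_divide_iff divide_less_0_iff)
  then show "morse_index (perimF d ix) (polyS d ix) x + (if 0 < perimF d ix x then 1 else 0)
       = card {m \<in> {2..<CARD('n)}. 0 < r * fan_coef d m}"
    unfolding f M using morse_index_level_set[OF xM] by (simp only: pos_count_def)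
  show "perimF d ix x \<noteq> 0" unfolding f using xM by (rule B_nonzero_on_level_set)
qed


theorem mainTheorem6:
  fixes d :: "nat \<Rightarrow> complex" and ix :: "nat \<Rightarrow> 'n::finite"
    and x :: "real^'n" and X :: complex and r :: real
  assumes n3: "CARD('n) \<ge> 3"
    and ix: "bij_betw ix {..<CARD('n)} UNIV"
    and dnz: "\<forall>i<CARD('n). d i \<noteq> 0"
    and nonpar: "\<forall>i<CARD('n). \<forall>j<CARD('n). i \<noteq> j \<longrightarrow> cross (d i) (d j) \<noteq> 0"
    and QS: "x \<in> polyS d ix"
    and inc: "is_incircle CARD('n) d (offs ix x) X r"
  shows
    "(r > 0 \<longrightarrow>
        nondeg_critical_point (perimF d ix) (polyS d ix) x \<and>
        real (morse_index (perimF d ix) (polyS d ix) x) =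
          real (RT CARD('n) d) - 1 + 2 * winding_poly CARD('n) d (offs ix x) X
          - (if perimF d ix x > 0 then 1 else 0)) \<and>
     (r < 0 \<longrightarrow>
        real (morse_index (perimF d ix) (polyS d ix) x) =
          real CARD('n) - 3 - real (morse_index (perimF d ix) (polyS d ix) (- x)) \<and>
        real (morse_index (perimF d ix) (polyS d ix) x) =
          real (LT CARD('n) d) - 1 - 2 * winding_poly CARD('n) d (offs ix x) X
          - (if perimF d ix x > 0 then 1 else 0))"
proof -
  interpret slopes "CARD('n)" d
    by unfold_locales (use n3 nonpar in auto)
  define p where "p = card {m \<in> {2..<CARD('n)}. 0 < fan_coef d m}"
  define q where "q = card {m \<in> {2..<CARD('n)}. fan_coef d m < 0}"
  have "{m \<in> {2..<CARD('n)}. 0 < fan_coef d m} \<union> {m \<in> {2..<CARD('n)}. fan_coef d m < 0} = {2..<CARD('n)}"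
    using fan_coef_nonzero by (fastforce simp: linorder_neq_iff)
  moreover have "card ({m \<in> {2..<CARD('n)}. 0 < fan_coef d m} \<union> {m \<in> {2..<CARD('n)}. fan_coef d m < 0}) = p + q"
    unfolding p_def q_def by (rule card_Un_disjoint) auto
  ultimately have pq: "p + q = CARD('n) - 2" by simp
  have tangent: "offs ix x i = cross (d i) X - r * cmod (d i)" if "i < CARD('n)" for i
    using offset_if_incircle[OF inc that] .
  have r: "r \<noteq> 0" using inc by (simp add: is_incircle_def)
  have p: "real p = real (RT CARD('n) d) - 1 + 2 * winding_poly CARD('n) d (offs ix x) X"
    unfolding p_def card_fan_coef_pos winding_poly_eq[OF inc] by simp
  have q: "real q = real (LT CARD('n) d) - 1 - 2 * winding_poly CARD('n) d (offs ix x) X"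
    using p pq RT_plus_LT n3 by linarith
  have offs_minus: "offs ix (- x) = (\<lambda>i. - offs ix x i)" by (auto simp: offs_def)
  have fan_height_minus: "fan_height d m (\<lambda>i. - h i) = - fan_height d m h" for m h
    using fan_height_scale[of d m "-1" h] by simp
  have mx: "- x \<in> polyS d ix"
    using QS by (simp add: polyS_def area_eq offs_minus area_form_def fan_height_minus)
  have P_minus: "perimF d ix (- x) = - perimF d ix x"
    by (simp add: perimF_def perim_eq offs_minus area_form_def fan_height_minus sum_negf)
  \<comment> \<open>The point reflection keeps the directed slopes and negates both the center and
    the signed radius.\<close>
  have tangent_minus: "offs ix (- x) i = cross (d i) (- X) - (- r) * cmod (d i)" if "i < CARD('n)" for i
    using tangent[OF that] by (simp add: offs_minus cross_altdef)
  have sl: "slopes CARD('n) d" by unfold_locales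
  note Q = tangential_polygon[OF sl ix QS r tangent]
  have "- r \<noteq> 0" using r by simp
  note mQ = tangential_polygon[OF sl ix mx this tangent_minus]
  have count: "card {m \<in> {2..<CARD('n)}. 0 < s * fan_coef d m} = (if 0 < s then p else q)"
    if "s \<noteq> 0" for s
    using that by (auto simp: p_def q_def zero_less_mult_iff intro!: arg_cong[of _ _ card])
  show ?thesis
  proof (intro conjI impI)
    assume "0 < r"
    then show "nondeg_critical_point (perimF d ix) (polyS d ix) x" using Q(1) by simp
    show "real (morse_index (perimF d ix) (polyS d ix) x) =
        real (RT CARD('n) d) - 1 + 2 * winding_poly CARD('n) d (offs ix x) X
        - (if perimF d ix x > 0 then 1 else 0)"
      using Q(2) count[OF r] p \<open>0 < r\<close> by (simp split: if_splits)
  next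
    assume "r < 0"
    then have neg: "real (morse_index (perimF d ix) (polyS d ix) x) + (if 0 < perimF d ix x then 1 else 0) = real q"
      using Q(2) count[OF r] by (simp split: if_splits)
    have "real (morse_index (perimF d ix) (polyS d ix) (- x)) + (if perimF d ix x < 0 then 1 else 0) = real p"
      using mQ(2) count[of "- r"] \<open>r < 0\<close> by (simp add: P_minus split: if_splits)
    \<comment> \<open>The two formulas add up to \<open>p + q = n - 2\<close>. The perimeter is
      nonzero, so exactly one of \<open>Q\<close> and \<open>-Q\<close> has positive perimeter,
      which leaves \<open>n - 3\<close>.\<close>
    with neg Q(3) pq n3
    show "real (morse_index (perimF d ix) (polyS d ix) x) =
        real CARD('n) - 3 - real (morse_index (perimF d ix) (polyS d ix) (- x))"
      by (cases "0 < perimF d ix x") (simp_all add: linorder_neq_iff)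
    show "real (morse_index (perimF d ix) (polyS d ix) x) =
        real (LT CARD('n) d) - 1 - 2 * winding_poly CARD('n) d (offs ix x) X
        - (if perimF d ix x > 0 then 1 else 0)"
      using neg q by (simp split: if_splits)
  qed
qed

end
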